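(* Let $\mathcal I,\mathcal J$ be ideals on $\omega$. If $\mathcal I$ contains a tall summable ideal and Player I has a winning strategy in the game $G(\mathcal J,A,f)$ for all $A\notin\mathcal J$ and all $\mathcal J$-to-one functions $f:A\to\omega$ (in particular, if $\mathcal I$ contains a tall summable ideal and $\mathcal J$ is a Borel ideal such that for each $A\notin\mathcal J$ the ideal $\mathcal J\restriction A$ is not $\le_K$-above any tall summable ideal), then $$\operatorname{cov}(\mathcal M)\le\mathfrak{fip}(\mathcal I,\mathcal J,\omega^\omega).$$
   Context: An ideal on a set $X$ is a family of subsets of $X$ closed under finite unions and subsets, containing all finite subsets of $X$ and not containing $X$; $\mathcal J^+=\mathcal P(X)\setminus\mathcal J$. Borel refers to the topology of $\mathcal P(\omega)\cong\{0,1\}^\omega$. $\operatorname{cov}(\mathcal M)$ is the least number of meager sets covering the real line; $\mathfrak c=2^{\aleph_0}$. A summable ideal is $\mathcal I_g=\{A\subseteq\omega:\sum_{n\in A}g(n)<\infty\}$ with $g:\omega\to[0,\infty)$, $\sum_{n\in\omega}g(n)=\infty$; it is tall (every infinite subset of $\omega$ contains an infinite member) iff $g(n)\to0$. $\mathcal J\restriction A=\{B\cap A:B\in\mathcal J\}$ is an ideal on $A$ for $A\notin\mathcal J$; it is $\le_K$-above $\mathcal I_g$ if there is $f:A\to\omega$ with $f^{-1}[B]\in\mathcal J\restriction A$ for all $B\in\mathcal I_g$. A function $f:A\to\omega$ is $\mathcal J$-to-one if $f^{-1}[\{n\}]\in\mathcal J$ for every $n$. The game $G(\mathcal J,A,f)$: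 first Player I plays $k_0\in\omega$; then, for $n=0,1,2,\dots$, Player II plays a finite set $G_n\subseteq\omega$ and Player I responds with $(F_n,k_{n+1})$, where $F_n\subseteq\omega$ is finite, $F_n\cap G_n=\emptyset$, $|F_n|\le k_n$, and $k_{n+1}\in\omega$. Player I wins iff $f^{-1}[\bigcup_nF_n]\notin\mathcal J\restriction A$; otherwise Player II wins. A nonempty family $\mathcal A\subseteq\mathcal P(\omega)$ has $\mathcal J^+$-FIP if $\bigcap F\in\mathcal J^+$ for each finite $F\subseteq\mathcal A$. $\mathfrak{fip}(\mathcal I,\mathcal J,\mathcal F)$ (for $\mathcal F\subseteq\omega^\omega$) is the minimum of the set consisting of $\mathfrak c^+$ and all cardinals $|\mathcal A|$ such that $\mathcal A\subseteq\mathcal P(\omega)$ has $\mathcal J^+$-FIP and it is not true that for every $f\in\mathcal F$ there is $B\in\mathcal I$ such that $\mathcal A\cup\{f^{-1}[B]\}$ has $\mathcal J^+$-FIP. *)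

theory Defs
  imports "HOL-Analysis.Analysis"
begin

unbundle cardinal_syntax

section \<open>Ideals\<close>

definition ideal_on :: "'a set \<Rightarrow> 'a set set \<Rightarrow> bool" where
  "ideal_on X J \<longleftrightarrow>
     J \<subseteq> Pow X \<and>
     (\<forall>A\<in>J. \<forall>B\<in>J. A \<union> B \<in> J) \<and>
     (\<forall>A\<in>J. \<forall>B\<subseteq>A. B \<in> J) \<and>
     (\<forall>A\<subseteq>X. finite A \<longrightarrow> A \<in> J) \<and>
     X \<notin> J"

definition restrict_ideal :: "'a set set \<Rightarrow> 'a set \<Rightarrow> 'a set set" where
  "restrict_ideal J A = {B \<inter> A | B. B \<in> J}"

definition tall :: "nat set set \<Rightarrow> bool" where
  "tall J \<longleftrightarrow> (\<forall>X. infinite X \<longrightarrow> (\<exists>Y\<subseteq>X. infinite Y \<and> Y \<in> J))"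

definition summable_ideal :: "(nat \<Rightarrow> real) \<Rightarrow> nat set set" where
  "summable_ideal g = {A. g summable_on A}"

definition is_summable_ideal :: "nat set set \<Rightarrow> bool" where
  "is_summable_ideal S \<longleftrightarrow>
     (\<exists>g. (\<forall>n. 0 \<le> g n) \<and> \<not> g summable_on UNIV \<and> S = summable_ideal g)"

text \<open>The topology on \<open>nat set\<close> is that of the product \<open>nat \<Rightarrow> bool\<close> of discrete spaces,
  transferred along characteristic functions.\<close>

definition borel_family :: "nat set set \<Rightarrow> bool" where
  "borel_family J \<longleftrightarrow> {x :: nat \<Rightarrow> bool. {n. x n} \<in> J} \<in> sets borel"

text \<open>Here and below, a function from \<open>A\<close> to \<open>nat\<close> is represented by a total function whose
  values outside \<open>A\<close> are irrelevant; the preimage of \<open>B\<close> is \<open>f -` B \<inter> A\<close>.\<close>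

definition katetov_above :: "nat set \<Rightarrow> nat set set \<Rightarrow> nat set set \<Rightarrow> bool" where
  "katetov_above A K S \<longleftrightarrow> (\<exists>f :: nat \<Rightarrow> nat. \<forall>B\<in>S. f -` B \<inter> A \<in> K)"

definition ideal_to_one :: "nat set set \<Rightarrow> nat set \<Rightarrow> (nat \<Rightarrow> nat) \<Rightarrow> bool" where
  "ideal_to_one J A f \<longleftrightarrow> (\<forall>n. f -` {n} \<inter> A \<in> J)"


section \<open>The game\<close>

text \<open>A strategy of Player I is an initial move \<open>k0\<close> together with a map \<open>\<sigma>\<close> sending the list
  \<open>[G 0, \<dots>, G n]\<close> of the moves made so far by Player II to the response \<open>(F n, k (n + 1))\<close>.\<close>

type_synonym strategy = "nat \<times> (nat set list \<Rightarrow> nat set \<times> nat)"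

definition play_F :: "strategy \<Rightarrow> (nat \<Rightarrow> nat set) \<Rightarrow> nat \<Rightarrow> nat set" where
  "play_F s G n = fst (snd s (map G [0..<Suc n]))"

fun play_k :: "strategy \<Rightarrow> (nat \<Rightarrow> nat set) \<Rightarrow> nat \<Rightarrow> nat" where
  "play_k s G 0 = fst s"
| "play_k s G (Suc n) = snd (snd s (map G [0..<Suc n]))"

definition winning_strategy_I :: "nat set set \<Rightarrow> nat set \<Rightarrow> (nat \<Rightarrow> nat) \<Rightarrow> strategy \<Rightarrow> bool" where
  "winning_strategy_I J A f s \<longleftrightarrow>
     (\<forall>G. (\<forall>n. finite (G n)) \<longrightarrow>
        (\<forall>n. finite (play_F s G n) \<and> play_F s G n \<inter> G n = {} \<and>
             card (play_F s G n) \<le> play_k s G n) \<and>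
        f -` (\<Union>n. play_F s G n) \<inter> A \<notin> restrict_ideal J A)"

definition I_wins_all_games :: "nat set set \<Rightarrow> bool" where
  "I_wins_all_games J \<longleftrightarrow>
     (\<forall>A f. A \<notin> J \<longrightarrow> ideal_to_one J A f \<longrightarrow> (\<exists>s. winning_strategy_I J A f s))"


section \<open>Cardinal invariants\<close>

text \<open>Cardinals are represented by cardinal well-orders, as in the library, so a minimum is
  determined only up to \<open>=o\<close>.\<close>

definition min_card :: "'a rel set \<Rightarrow> 'a rel" where
  "min_card R = (SOME r. r \<in> R \<and> (\<forall>r'\<in>R. r \<le>o r'))"

lemma min_card:
  assumes "R \<noteq> {}" and "\<And>r. r \<in> R \<Longrightarrow> Card_order r"
  shows min_card_in: "min_card R \<in> R"
    and min_card_le: "r' \<in> R \<Longrightarrow> min_card R \<le>o r'"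
proof -
  have "\<exists>r. r \<in> R \<and> (\<forall>r'\<in>R. r \<le>o r')"
    using exists_minim_Card_order[of R] assms by blast
  then have "min_card R \<in> R \<and> (\<forall>r'\<in>R. min_card R \<le>o r')"
    unfolding min_card_def by (rule someI_ex)
  then show "min_card R \<in> R" and "r' \<in> R \<Longrightarrow> min_card R \<le>o r'"
    by auto
qed

definition nowhere_dense :: "'a::topological_space set \<Rightarrow> bool" where
  "nowhere_dense S \<longleftrightarrow> interior (closure S) = {}"

definition meager :: "'a::topological_space set \<Rightarrow> bool" where
  "meager S \<longleftrightarrow> (\<exists>N :: nat \<Rightarrow> 'a set. (\<forall>n. nowhere_dense (N n)) \<and> S = (\<Union>n. N n))"

definition cov_meager_cards :: "real set rel set" where
  "cov_meager_cards = {|\<C>| | \<C> :: real set set. (\<forall>M\<in>\<C>. meager M) \<and> \<Union>\<C> = UNIV}"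

definition cov_meager :: "real set rel" where
  "cov_meager = min_card cov_meager_cards"

definition has_FIP :: "nat set set \<Rightarrow> nat set set \<Rightarrow> bool" where
  "has_FIP J \<A> \<longleftrightarrow> \<A> \<noteq> {} \<and> (\<forall>F\<subseteq>\<A>. finite F \<longrightarrow> \<Inter>F \<notin> J)"

text \<open>All members are cardinals on the type carrying \<open>cardSuc |UNIV :: nat set set|\<close>, the
  successor of the continuum; up to \<open>=o\<close>, each \<open>|\<A>|\<close> is such a cardinal.\<close>

definition fip_cards ::
    "nat set set \<Rightarrow> nat set set \<Rightarrow> (nat \<Rightarrow> nat) set \<Rightarrow> nat set set rel set" where
  "fip_cards I J \<F> =
     {cardSuc |UNIV :: nat set set| } \<union>
     {r. Card_order r \<and> (\<exists>\<A> :: nat set set. r =o |\<A>| \<and> has_FIP J \<A> \<and>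
          \<not> (\<forall>f\<in>\<F>. \<exists>B\<in>I. has_FIP J (\<A> \<union> {f -` B})))}"

definition fip :: "nat set set \<Rightarrow> nat set set \<Rightarrow> (nat \<Rightarrow> nat) set \<Rightarrow> nat set set rel" where
  "fip I J \<F> = min_card (fip_cards I J \<F>)"

lemma meager_singleton: "meager {x::real}"
  unfolding meager_def nowhere_dense_def by (intro exI[of _ "\<lambda>_. {x}"]) auto

lemma cov_meager_cards_nonempty: "cov_meager_cards \<noteq> {}"
proof -
  have "|range (\<lambda>x::real. {x})| \<in> cov_meager_cards"
    unfolding cov_meager_cards_def using meager_singleton by blast
  then show ?thesis by blast
qed

lemma Card_order_cov_meager_cards: "r \<in> cov_meager_cards \<Longrightarrow> Card_order r"
  unfolding cov_meager_cards_def by (auto simp: card_of_Card_order)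

lemma fip_cards_nonempty: "fip_cards I J \<F> \<noteq> {}"
  unfolding fip_cards_def by blast

lemma Card_order_fip_cards: "r \<in> fip_cards I J \<F> \<Longrightarrow> Card_order r"
  unfolding fip_cards_def by (auto simp: cardSuc_Card_order card_of_Card_order)

lemma card_in_fip_cards:
  assumes "has_FIP J \<A>" and "\<not> (\<forall>f\<in>\<F>. \<exists>B\<in>I. has_FIP J (\<A> \<union> {f -` B}))"
  shows "\<exists>r\<in>fip_cards I J \<F>. r =o |\<A>|"
proof -
  have "bij_betw (\<lambda>X. {X}) \<A> ((\<lambda>X. {X}) ` \<A>)"
    by (auto simp: bij_betw_def inj_on_def)
  then have "|(\<lambda>X. {X}) ` \<A>| =o |\<A>|"
    using card_of_ordIso ordIso_symmetric by blast
  moreover from this have "|(\<lambda>X. {X}) ` \<A>| \<in> fip_cards I J \<F>"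
    unfolding fip_cards_def using assms card_of_Card_order by blast
  ultimately show ?thesis by blast
qed

end

theory Submission
  imports Defs
begin

text \<open>
  A real number \<open>r\<close> codes a sequence of finite sets, the \<open>n\<close>-th of weight at most \<open>2\<^sup>-\<^sup>n\<close>, whose
  union \<open>B\<close> lies in the summable ideal. If Player I has a winning strategy in \<open>G(J, A, f)\<close>, let
  Player II exclude all points of weight above a suitable threshold. For generic \<open>r\<close> the responses
  of Player I then occur among the blocks of \<open>r\<close>, so \<open>f\<^sup>-\<^sup>1[B] \<inter> A\<close> is \<open>J\<close>-positive for all \<open>r\<close>
  outside a meager set. Should no generic \<open>B\<close> work for a given family, these meager sets, one for
  each finite intersection of the family, cover the real line.

  For Borel \<open>J\<close>, determinacy of open games suffices. In an auxiliary game Player II must also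
  produce, digit by digit, a set \<open>Z \<in> J\<close> containing \<open>f\<^sup>-\<^sup>1[\<Union>F\<^sub>n] \<inter> A\<close> together with a witness for
  \<open>Z \<in> J\<close>; Player I wins iff Player II fails at a finite stage. A winning strategy of Player I
  there yields one in \<open>G(J, A, f)\<close> by simulating all possible digit sequences at once: enlarging
  \<open>\<Union>F\<^sub>n\<close> does no harm, because \<open>Z\<close> is only required to contain the preimage. If there is none,
  Player II never loses by avoiding lost positions, and the growth of her moves defines a tall
  summable ideal that \<open>f\<close> reduces to \<open>J\<restriction>A\<close>.
\<close>

section \<open>Borel sets are analytic\<close>

text \<open>A projection of a closed set: the pairs \<open>(x, y)\<close> satisfying all \<open>P n\<close> form a closed set,
  since \<open>P n\<close> depends on the first \<open>n\<close> entries only.\<close>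

definition analytic :: "(nat \<Rightarrow> bool) set \<Rightarrow> bool" where
  "analytic S \<longleftrightarrow>
     (\<exists>P :: nat \<Rightarrow> (nat \<Rightarrow> bool) \<Rightarrow> (nat \<Rightarrow> nat) \<Rightarrow> bool.
        (\<forall>n x x' y y'. (\<forall>i<n. x i = x' i \<and> y i = y' i) \<longrightarrow> P n x y \<longrightarrow> P n x' y') \<and>
        S = {x. \<exists>y. \<forall>n. P n x y})"

lemma analyticI:
  assumes "\<And>n x x' y y'. (\<And>i. i < n \<Longrightarrow> x i = x' i) \<Longrightarrow> (\<And>i. i < n \<Longrightarrow> y i = y' i) \<Longrightarrow>
      P n x y \<Longrightarrow> P n x' y'"
    and "\<And>x. x \<in> S \<longleftrightarrow> (\<exists>y :: nat \<Rightarrow> nat. \<forall>n. P n x y)"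
  shows "analytic S"
  unfolding analytic_def
  using assms by (intro exI[of _ P]) blast

lemma analytic_UN:
  assumes "\<And>i::nat. analytic (S i)"
  shows "analytic (\<Union>i. S i)"
proof -
  obtain P where loc: "\<And>i n x x' y y'. (\<forall>j<n. x j = x' j \<and> y j = y' j) \<Longrightarrow> P i n x y \<Longrightarrow> P i n x' y'"
    and S: "\<And>i. S i = {x. \<exists>y::nat\<Rightarrow>nat. \<forall>n. P i n x y}"
    using assms unfolding analytic_def by metis
  \<comment> \<open>Entry 0 of the witness selects the index; condition \<open>Suc m\<close> is
    condition \<open>m\<close> for that index, read on the shifted witness. Stage 0 is vacuous
    because not even entry 0 may be read there.\<close>
  show ?thesis
  proof (rule analyticI[where P = "\<lambda>n x y. case n of 0 \<Rightarrow> True | Suc m \<Rightarrow> P (y 0) m x (\<lambda>j. y (Suc j))"])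
    fix n x x' and y y' :: "nat \<Rightarrow> nat"
    assume "\<And>i. i < n \<Longrightarrow> x i = x' i" "\<And>i. i < n \<Longrightarrow> y i = y' i"
      and "case n of 0 \<Rightarrow> True | Suc m \<Rightarrow> P (y 0) m x (\<lambda>j. y (Suc j))"
    then show "case n of 0 \<Rightarrow> True | Suc m \<Rightarrow> P (y' 0) m x' (\<lambda>j. y' (Suc j))"
      using loc[where x = x and x' = x' and y = "\<lambda>j. y (Suc j)" and y' = "\<lambda>j. y' (Suc j)"]
      by (auto split: nat.splits)
  next
    fix x
    show "x \<in> (\<Union>i. S i) \<longleftrightarrow>
        (\<exists>y. \<forall>n. case n of 0 \<Rightarrow> True | Suc m \<Rightarrow> P (y 0) m x (\<lambda>j. y (Suc j)))"
    proof
      assume "x \<in> (\<Union>i. S i)"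
      then obtain i y where "\<And>n. P i n x y" unfolding S by blast
      then show "\<exists>y. \<forall>n. case n of 0 \<Rightarrow> True | Suc m \<Rightarrow> P (y 0) m x (\<lambda>j. y (Suc j))"
        by (intro exI[of _ "case_nat i y"]) (auto split: nat.splits)
    next
      assume "\<exists>y. \<forall>n. case n of 0 \<Rightarrow> True | Suc m \<Rightarrow> P (y 0) m x (\<lambda>j. y (Suc j))"
      then obtain y where "\<And>n. P (y 0) n x (\<lambda>j. y (Suc j))"
        by (metis nat.simps(5))
      then show "x \<in> (\<Union>i. S i)" unfolding S by blast
    qed
  qed
qed

lemma analytic_INT:
  assumes "\<And>i::nat. analytic (S i)"
  shows "analytic (\<Inter>i. S i)"
proof -
  obtain P where loc: "\<And>i n x x' y y'. (\<forall>j<n. x j = x' j \<and> y j = y' j) \<Longrightarrow> P i n x y \<Longrightarrow> P i n x' y'"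
    and S: "\<And>i. S i = {x. \<exists>y::nat\<Rightarrow>nat. \<forall>n. P i n x y}"
    using assms unfolding analytic_def by metis
  \<comment> \<open>The entries \<open>y (prod_encode (i, j))\<close> form the witness for the
    \<open>i\<close>-th set. Condition \<open>prod_encode (i, m)\<close> stays local since
    \<open>prod_encode (i, j) < prod_encode (i, m)\<close> for \<open>j < m\<close>.\<close>
  let ?Q = "\<lambda>n x y. P (fst (prod_decode n)) (snd (prod_decode n)) x
              (\<lambda>j. y (prod_encode (fst (prod_decode n), j)))"
  show ?thesis
  proof (rule analyticI[where P = ?Q])
    fix n x x' and y y' :: "nat \<Rightarrow> nat"
    assume eq: "\<And>i. i < n \<Longrightarrow> x i = x' i" "\<And>i. i < n \<Longrightarrow> y i = y' i" and "?Q n x y"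
    obtain i m where n: "prod_decode n = (i, m)" by (cases "prod_decode n")
    then have n': "n = prod_encode (i, m)" by (metis prod_decode_inverse)
    have "prod_encode (i, j) < n" if "j < m" for j
      using that unfolding n'
    proof (induction m)
      case (Suc m)
      have "prod_encode (i, m) < prod_encode (i, Suc m)" by (simp add: prod_encode_def)
      with Suc show ?case by (cases "j = m") auto
    qed simp
    moreover have "m \<le> n" using le_prod_encode_2 n' by simp
    ultimately show "?Q n x' y'"
      using \<open>?Q n x y\<close> eq unfolding n fst_conv snd_conv
      by (intro loc[where n = m and x = x and x' = x' and y = "\<lambda>j. y (prod_encode (i, j))"
            and y' = "\<lambda>j. y' (prod_encode (i, j))"]) auto
  next
    fix x
    show "x \<in> (\<Inter>i. S i) \<longleftrightarrow> (\<exists>y. \<forall>n. ?Q n x y)"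
    proof
      assume "x \<in> (\<Inter>i. S i)"
      then have "\<forall>i. \<exists>y. \<forall>n. P i n x y" unfolding S by simp
      then obtain Y where Y: "\<And>i n. P i n x (Y i)" by metis
      show "\<exists>y. \<forall>n. ?Q n x y"
        by (rule exI[of _ "\<lambda>k. Y (fst (prod_decode k)) (snd (prod_decode k))"]) (simp add: Y)
    next
      assume "\<exists>y. \<forall>n. ?Q n x y"
      then obtain y where y: "\<And>n. ?Q n x y" by blast
      have "P i n x (\<lambda>j. y (prod_encode (i, j)))" for i n
        using y[of "prod_encode (i, n)"] by (simp only: prod_encode_inverse fst_conv snd_conv)
      then show "x \<in> (\<Inter>i. S i)" unfolding S by blast
    qed
  qed
qed

lemma open_nat_bool_cylinder:
  fixes U :: "(nat \<Rightarrow> bool) set"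
  assumes "open U" "x \<in> U"
  shows "\<exists>N. \<forall>x'. (\<forall>i<N. x' i = x i) \<longrightarrow> x' \<in> U"
proof -
  have "openin (product_topology (\<lambda>i::nat. euclidean :: bool topology) UNIV) U"
    using assms(1) by (simp add: open_fun_def)
  then obtain X where X: "finite {i. X i \<noteq> UNIV}" "x \<in> Pi\<^sub>E UNIV X" "Pi\<^sub>E UNIV X \<subseteq> U"
    using assms(2) unfolding openin_product_topology_alt by auto
  obtain N where N: "\<forall>i\<in>{i. X i \<noteq> UNIV}. i < N"
    using X(1) finite_nat_set_iff_bounded by blast
  have "x' \<in> U" if "\<forall>i<N. x' i = x i" for x'
  proof -
    have "x' i \<in> X i" for i
      using N X(2) that by (cases "X i = UNIV") (auto simp: PiE_iff)
    then show ?thesis using X(3) by (auto simp: PiE_iff)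
  qed
  then show ?thesis by blast
qed

text \<open>The witness \<open>y 0\<close> is the length of an initial segment of \<open>x\<close>
  that forces membership in \<open>U\<close>. The condition waits for a positive stage
  \<open>n \<ge> y 0\<close>, where \<open>y 0\<close> and this segment are visible.\<close>

lemma analytic_open:
  assumes "open U" shows "analytic U" 
proof (rule analyticI[where P = "\<lambda>n x y. 0 < n \<and> y 0 \<le> n \<longrightarrow> (\<forall>x'. (\<forall>i<y 0. x' i = x i) \<longrightarrow> x' \<in> U)"])
  fix x
  show "x \<in> U \<longleftrightarrow> (\<exists>y. \<forall>n::nat. 0 < n \<and> y (0::nat) \<le> n \<longrightarrow> (\<forall>x'. (\<forall>i<y 0. x' i = x i) \<longrightarrow> x' \<in> U))"
    (is "_ \<longleftrightarrow> ?R")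
  proof
    assume "x \<in> U"
    then obtain N where "\<forall>x'. (\<forall>i<N. x' i = x i) \<longrightarrow> x' \<in> U"
      using open_nat_bool_cylinder[OF assms] by blast
    then show ?R by (intro exI[of _ "\<lambda>_. N"]) simp
  next
    assume ?R
    then obtain y where "\<And>n. 0 < n \<Longrightarrow> y 0 \<le> n \<Longrightarrow> (\<forall>x'. (\<forall>i<y (0::nat). x' i = x i) \<longrightarrow> x' \<in> U)"
      by blast
    from this[of "Suc (y 0)"] show "x \<in> U" by simp
  qed
qed auto

text \<open>A point lies outside an open set iff each of its initial segments extends to a point
  outside.\<close>

lemma analytic_closed:
  assumes "open U" shows "analytic (- U)"
proof (rule analyticI[where P = "\<lambda>n x y. \<exists>x'. (\<forall>i<n. x' i = x i) \<and> x' \<notin> U"])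
  show "\<And>x. x \<in> - U \<longleftrightarrow> (\<exists>y::nat\<Rightarrow>nat. \<forall>n. \<exists>x'. (\<forall>i<n. x' i = x i) \<and> x' \<notin> U)"
    using open_nat_bool_cylinder[OF assms] by (metis ComplD ComplI)
qed auto

lemma analytic_borel:
  assumes "S \<in> sets (borel :: (nat \<Rightarrow> bool) measure)"
  shows "analytic S"
proof -
  have "S \<in> sigma_sets UNIV {S. open S}" using assms by (simp add: borel_def)
  \<comment> \<open>The induction carries complements along, because the complement of an analytic
    set need not be analytic.\<close>
  then have "analytic S \<and> analytic (- S)"
  proof induction
    case (Basic U)
    then show ?case using analytic_open analytic_closed by simp
  next
    case Empty
    show ?case using analytic_open[of "{}"] analytic_open[of UNIV] by simp
  next
    case (Compl S)
    then show ?case by (simp add: Compl_eq_Diff_UNIV[symmetric])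
  next
    case (Union S)
    then show ?case using analytic_UN[of S] analytic_INT[of "\<lambda>i. - S i"] by simp
  qed
  then show ?thesis ..
qed

text \<open>The sequence \<open>w\<close> codes both a set, by the parities of its entries, and a witness for
  membership of this set in \<open>J\<close>, by their halves.\<close>

lemma borel_family_witnesses:
  assumes "borel_family J"
  shows "\<exists>Q :: nat \<Rightarrow> (nat \<Rightarrow> nat) \<Rightarrow> bool.
    (\<forall>n w w'. (\<forall>i<n. w i = w' i) \<longrightarrow> Q n w \<longrightarrow> Q n w') \<and>
    (\<forall>Z. Z \<in> J \<longleftrightarrow> (\<exists>w. Z = {i. odd (w i)} \<and> (\<forall>n. Q n w)))"
proof -
  obtain P where loc: "\<And>n x x' y y'. (\<forall>i<n. x i = x' i \<and> y i = y' i) \<Longrightarrow> P n x y \<Longrightarrow> P n x' y'"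
    and P: "{x. {n. x n} \<in> J} = {x. \<exists>y::nat\<Rightarrow>nat. \<forall>n. P n x y}"
    using analytic_borel[OF assms[unfolded borel_family_def], unfolded analytic_def]
    by (elim exE conjE) blast
  define Q where "Q n w = P n (\<lambda>i. odd (w i)) (\<lambda>i. w i div 2)" for n and w :: "nat \<Rightarrow> nat"
  have J: "Z \<in> J \<longleftrightarrow> (\<exists>y. \<forall>n. P n (\<lambda>i. i \<in> Z) y)" for Z
  proof -
    have "{i. i \<in> Z} \<in> J \<longleftrightarrow> (\<lambda>i. i \<in> Z) \<in> {x. {n. x n} \<in> J}" by simp
    then show ?thesis unfolding P by simp
  qed
  show ?thesis
  proof (intro exI[of _ Q] conjI allI impI)
    fix Z
    show "Z \<in> J \<longleftrightarrow> (\<exists>w. Z = {i. odd (w i)} \<and> (\<forall>n. Q n w))"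
    proof
      assume "Z \<in> J"
      then obtain y where y: "\<And>n. P n (\<lambda>i. i \<in> Z) y" unfolding J by blast
      have "(\<lambda>i. odd (2 * y i + (if i \<in> Z then 1 else 0))) = (\<lambda>i. i \<in> Z)"
        "(\<lambda>i. (2 * y i + (if i \<in> Z then 1 else 0)) div 2) = y" by auto
      then show "\<exists>w. Z = {i. odd (w i)} \<and> (\<forall>n. Q n w)"
        by (intro exI[of _ "\<lambda>i. 2 * y i + (if i \<in> Z then 1 else 0)"]) (auto simp: Q_def y)
    next
      assume "\<exists>w. Z = {i. odd (w i)} \<and> (\<forall>n. Q n w)"
      then obtain w where Z: "Z = {i. odd (w i)}" and w: "\<And>n. Q n w" by blast
      show "Z \<in> J" unfolding J Z using w unfolding Q_def by auto
    qed
  next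
    fix n and w w' :: "nat \<Rightarrow> nat"
    assume "\<forall>i<n. w i = w' i" "Q n w"
    then show "Q n w'"
      using loc[of n "\<lambda>i. odd (w i)" "\<lambda>i. odd (w' i)" "\<lambda>i. w i div 2" "\<lambda>i. w' i div 2"]
      unfolding Q_def by simp
  qed
qed

section \<open>The auxiliary open game\<close>

lemma ideal_onD:
  assumes "ideal_on UNIV J"
  shows ideal_on_Un: "X \<in> J \<Longrightarrow> Y \<in> J \<Longrightarrow> X \<union> Y \<in> J"
    and ideal_on_subset: "X \<in> J \<Longrightarrow> Y \<subseteq> X \<Longrightarrow> Y \<in> J"
    and ideal_on_finite: "finite X \<Longrightarrow> X \<in> J"
  using assms unfolding ideal_on_def by auto

lemma in_restrict_ideal_iff:
  assumes "ideal_on UNIV J" "C \<subseteq> A"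
  shows "C \<in> restrict_ideal J A \<longleftrightarrow> C \<in> J"
  using assms ideal_on_subset[OF assms(1)] unfolding restrict_ideal_def by auto

text \<open>In the auxiliary game Player II also plays numbers \<open>a\<close>, which are recorded with the latest one
  first in a list \<open>s\<close>; \<open>U\<close> is the union of the sets played by Player I so far and \<open>V U s\<close> says that
  Player I has already won. Being a datatype, a strategy tree has no infinite branches, so following
  one forces such a win.\<close>

datatype strategy_tree = Won | Move "nat set \<Rightarrow> nat \<Rightarrow> nat set \<times> nat \<times> strategy_tree"

inductive winning_tree :: "(nat set \<Rightarrow> nat list \<Rightarrow> bool) \<Rightarrow>
    strategy_tree \<Rightarrow> nat \<Rightarrow> nat set \<Rightarrow> nat list \<Rightarrow> bool" for V where
  Won: "V U s \<Longrightarrow> winning_tree V Won k U s"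
| Move: "(\<And>G a. finite G \<Longrightarrow> \<exists>F k' t. r G a = (F, k', t) \<and> finite F \<and> F \<inter> G = {} \<and> card F \<le> k \<and>
            winning_tree V t k' (U \<union> F) (a # s)) \<Longrightarrow> winning_tree V (Move r) k U s"

lemma winning_tree_Move:
  assumes "winning_tree V (Move r) k U s" "finite G"
  shows "\<exists>F k' t. r G a = (F, k', t) \<and> finite F \<and> F \<inter> G = {} \<and> card F \<le> k \<and>
    winning_tree V t k' (U \<union> F) (a # s)"
  using assms(1) by (cases rule: winning_tree.cases) (use assms(2) in blast)

text \<open>If every legal move had a winning answer, choice would assemble these answers into one
  tree.\<close>

lemma no_winning_tree_step:
  assumes "\<And>t. \<not> winning_tree V t k U s"
  shows "\<exists>G a. finite G \<and> (\<forall>F k' t. finite F \<longrightarrow> F \<inter> G = {} \<longrightarrow> card F \<le> k \<longrightarrow>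
    \<not> winning_tree V t k' (U \<union> F) (a # s))"
proof (rule ccontr)
  assume "\<not> ?thesis"
  then have "\<forall>G a. \<exists>p. finite G \<longrightarrow> finite (fst p) \<and> fst p \<inter> G = {} \<and> card (fst p) \<le> k \<and>
      winning_tree V (snd (snd p)) (fst (snd p)) (U \<union> fst p) (a # s)"
    by (metis fst_conv snd_conv)
  then obtain r where "\<And>G a. finite G \<Longrightarrow> finite (fst (r G a)) \<and> fst (r G a) \<inter> G = {} \<and>
      card (fst (r G a)) \<le> k \<and>
      winning_tree V (snd (snd (r G a))) (fst (snd (r G a))) (U \<union> fst (r G a)) (a # s)"
    by metis
  then have "winning_tree V (Move r) k U s"
    by (intro winning_tree.Move) (metis prod.collapse)
  with assms show False by blast
qed

text \<open>Player II claims that her digits code a member of \<open>J\<close> containing the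
  preimage of \<open>U\<close> within \<open>A\<close>. The claim is tested only on the
  \<open>length s\<close> digits on record; for local \<open>Q\<close> the later values of
  \<open>w\<close> are irrelevant.\<close>

definition refuted ::
    "(nat \<Rightarrow> (nat \<Rightarrow> nat) \<Rightarrow> bool) \<Rightarrow> nat set \<Rightarrow> (nat \<Rightarrow> nat) \<Rightarrow> nat set \<Rightarrow> nat list \<Rightarrow> bool" where
  "refuted Q A f U s \<longleftrightarrow>
     \<not> (\<exists>w. (\<forall>i<length s. rev s ! i = w i) \<and> (\<forall>n\<le>length s. Q n w) \<and>
           (\<forall>i<length s. i \<in> A \<longrightarrow> f i \<in> U \<longrightarrow> odd (w i)))"

text \<open>The state after the auxiliary play in which Player II plays the numbers in \<open>s\<close>; each step
  reuses the move of Player II from the round of the original game coded by the extended list.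
  Lists have larger codes than their tails, so earlier rounds determine the state they extend.\<close>

primrec simulate ::
    "nat \<times> strategy_tree \<Rightarrow> (nat \<Rightarrow> nat set) \<Rightarrow> nat list \<Rightarrow> nat set \<times> nat \<times> strategy_tree" where
  "simulate p G [] = ({}, p)"
| "simulate p G (a # s) = (case snd (snd (simulate p G s)) of
       Won \<Rightarrow> ({}, 0, Won)
     | Move r \<Rightarrow> r (G (list_encode (a # s))) a)"

primrec simulated_union ::
    "nat \<times> strategy_tree \<Rightarrow> (nat \<Rightarrow> nat set) \<Rightarrow> nat list \<Rightarrow> nat set" where
  "simulated_union p G [] = {}"
| "simulated_union p G (a # s) = simulated_union p G s \<union> fst (simulate p G (a # s))"

text \<open>Round \<open>n\<close> serves the list \<open>list_decode n\<close>; round 0 serves the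
  empty list and gets an empty response, whence the initial bound 0. The round just played is
  \<open>length L - 1\<close>, but the bound announced is for round \<open>length L\<close> and
  comes from the state at the tail of its list.\<close>

definition simulation :: "nat \<times> strategy_tree \<Rightarrow> strategy" where
  "simulation p = (0, \<lambda>L. (fst (simulate p ((!) L) (list_decode (length L - 1))),
                          fst (snd (simulate p ((!) L) (tl (list_decode (length L)))))))"

lemma list_encode_less_Cons: "list_encode s < list_encode (a # s)"
  using le_prod_encode_2[of "list_encode s" a] by simp

lemma simulate_cong:
  "(\<And>i. i \<le> list_encode s \<Longrightarrow> G i = G' i) \<Longrightarrow> simulate p G s = simulate p G' s"
proof (induction s)
  case (Cons a s)
  then have "simulate p G s = simulate p G' s"
    using list_encode_less_Cons[of s a] by auto
  moreover have "G (list_encode (a # s)) = G' (list_encode (a # s))" by (rule Cons.prems) simp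
  ultimately show ?case by (simp del: list_encode.simps split: strategy_tree.split)
qed simp

lemma play_F_simulation: "play_F (simulation p) G n = fst (simulate p G (list_decode n))"
proof -
  have "simulate p ((!) (map G [0..<Suc n])) (list_decode n) = simulate p G (list_decode n)"
    by (intro simulate_cong) (simp add: list_decode_inverse del: upt_Suc)
  then show ?thesis by (simp add: play_F_def simulation_def del: upt_Suc list_decode.simps)
qed

lemma play_k_simulation:
  assumes "list_decode n = a # s"
  shows "play_k (simulation p) G n = fst (snd (simulate p G s))"
proof -
  have "list_encode (a # s) = n" using assms by (metis list_decode_inverse)
  then have "list_encode s < n" using list_encode_less_Cons by metis
  then obtain m where m: "n = Suc m" "list_encode s \<le> m" by (cases n) auto
  have "simulate p ((!) (map G [0..<Suc m])) s = simulate p G s"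
    using m by (intro simulate_cong) (simp del: upt_Suc)
  then show ?thesis using assms m by (simp add: simulation_def del: upt_Suc list_decode.simps)
qed

text \<open>The invariant is dropped once the tree is \<open>Won\<close>, because \<open>V\<close>
  is not assumed to persist when the list grows.\<close>

lemma simulate_invariant:
  assumes "winning_tree V t k {} []" "\<And>n. finite (G n)"
    and "simulate (k, t) G s = (F, k', t')"
  shows "t' = Won \<or> winning_tree V t' k' (simulated_union (k, t) G s) s"
  using assms(3)
proof (induction s arbitrary: F k' t')
  case Nil
  then show ?case using assms(1) by simp
next
  case (Cons a s)
  obtain F1 k1 t1 where 1: "simulate (k, t) G s = (F1, k1, t1)" by (metis prod_cases3)
  show ?case
  proof (cases t1)
    case Won
    then show ?thesis using Cons.prems 1 by simp
  next
    case (Move r)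
    then have "winning_tree V (Move r) k1 (simulated_union (k, t) G s) s" using Cons.IH[OF 1] by simp
    from winning_tree_Move[OF this assms(2)]
    obtain F2 k2 t2 where "r (G (list_encode (a # s))) a = (F2, k2, t2)"
      and "winning_tree V t2 k2 (simulated_union (k, t) G s \<union> F2) (a # s)"
      by blast
    then show ?thesis using Cons.prems 1 Move by (simp del: list_encode.simps)
  qed
qed

lemma simulate_legal:
  assumes "winning_tree V t k {} []" "\<And>n. finite (G n)"
  shows "finite (fst (simulate (k, t) G (a # s))) \<and>
    fst (simulate (k, t) G (a # s)) \<inter> G (list_encode (a # s)) = {} \<and>
    card (fst (simulate (k, t) G (a # s))) \<le> fst (snd (simulate (k, t) G s))"
proof -
  obtain F1 k1 t1 where 1: "simulate (k, t) G s = (F1, k1, t1)" by (metis prod_cases3)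
  show ?thesis
  proof (cases t1)
    case Won
    then show ?thesis using 1 by simp
  next
    case (Move r)
    then have "winning_tree V (Move r) k1 (simulated_union (k, t) G s) s"
      using simulate_invariant[OF assms 1] by simp
    from winning_tree_Move[OF this assms(2)[of "list_encode (a # s)"]]
    obtain F2 k2 t2 where "r (G (list_encode (a # s))) a = (F2, k2, t2)" "finite F2"
      "F2 \<inter> G (list_encode (a # s)) = {}" "card F2 \<le> k1"
      by blast
    then show ?thesis using 1 Move by (simp del: list_encode.simps)
  qed
qed

text \<open>Induction on the tree: each digit of \<open>w\<close> passes to a subtree, so the branch
  of \<open>w\<close> ends in a leaf \<open>Won\<close>, where \<open>V\<close> holds.\<close>

lemma simulate_reaches_refutation:
  assumes "winning_tree V t k U s" "\<And>n. finite (G n)"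
    and "s = rev (map w [0..<n])" "simulate p G s = (F, k, t)" "U = simulated_union p G s"
  shows "\<exists>n. V (simulated_union p G (rev (map w [0..<n]))) (rev (map w [0..<n]))"
  using assms
proof (induction arbitrary: F n rule: winning_tree.induct)
  case (Won U s k)
  then show ?case by auto
next
  case (Move r k U s)
  let ?G = "G (list_encode (w n # s))"
  obtain F' k' t' where *: "r ?G (w n) = (F', k', t')"
    and IH: "\<forall>F n'. w n # s = rev (map w [0..<n']) \<longrightarrow> simulate p G (w n # s) = (F, k', t') \<longrightarrow>
      U \<union> F' = simulated_union p G (w n # s) \<longrightarrow>
      (\<exists>n. V (simulated_union p G (rev (map w [0..<n]))) (rev (map w [0..<n])))"
    using Move.IH[of ?G "w n"] Move.prems(1) by blast
  have sim: "simulate p G (w n # s) = (F', k', t')"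
    using Move.prems(3) * by (simp del: list_encode.simps)
  then have "U \<union> F' = simulated_union p G (w n # s)"
    using Move.prems(4) by (simp del: list_encode.simps simulate.simps)
  moreover have "w n # s = rev (map w [0..<Suc n])" using Move.prems(2) by simp
  ultimately show ?case using IH sim by blast
qed

text \<open>If the resulting preimage were in \<open>J\<close>, take a sequence \<open>w\<close>
  coding it. The branch of \<open>w\<close> reaches a refutation, yet \<open>w\<close> itself passes
  the test, since the union along this branch is part of the union of all responses.\<close>

lemma simulation_wins:
  assumes J: "ideal_on UNIV J" "\<And>Z. Z \<in> J \<longleftrightarrow> (\<exists>w. Z = {i. odd (w i)} \<and> (\<forall>n. Q n w))"
    and t: "winning_tree (refuted Q A f) t k {} []"
  shows "winning_strategy_I J A f (simulation (k, t))"
  unfolding winning_strategy_I_def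
proof (intro allI impI conjI)
  fix G :: "nat \<Rightarrow> nat set" and n
  assume fin: "\<forall>n. finite (G n)"
  let ?F = "play_F (simulation (k, t)) G"
  have "finite (?F n) \<and> ?F n \<inter> G n = {} \<and> card (?F n) \<le> play_k (simulation (k, t)) G n"
  proof (cases "list_decode n")
    case Nil
    then show ?thesis by (simp add: play_F_simulation)
  next
    case (Cons a s)
    then have "list_encode (a # s) = n" by (metis list_decode_inverse)
    then show ?thesis
      using simulate_legal[OF t, of G a s] fin Cons play_F_simulation play_k_simulation by metis
  qed
  then show "finite (?F n)" "?F n \<inter> G n = {}" "card (?F n) \<le> play_k (simulation (k, t)) G n"
    by auto
next
  fix G :: "nat \<Rightarrow> nat set"
  assume fin: "\<forall>n. finite (G n)"
  let ?F = "play_F (simulation (k, t)) G"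
  have "f -` (\<Union>n. ?F n) \<inter> A \<notin> J"
  proof
    assume "f -` (\<Union>n. ?F n) \<inter> A \<in> J"
    then obtain w where w: "f -` (\<Union>n. ?F n) \<inter> A = {i. odd (w i)}" "\<And>n. Q n w"
      using J(2) by metis
    have sub: "simulated_union (k, t) G s \<subseteq> (\<Union>n. ?F n)" for s
    proof (induction s)
      case (Cons a s)
      have "fst (simulate (k, t) G (a # s)) = ?F (list_encode (a # s))"
        unfolding play_F_simulation list_encode_inverse ..
      with Cons show ?case by auto
    qed simp
    obtain n where "refuted Q A f (simulated_union (k, t) G (rev (map w [0..<n]))) (rev (map w [0..<n]))"
      using simulate_reaches_refutation[OF t, of G w 0 "(k, t)" "{}"] fin by auto
    then show False
      unfolding refuted_def using w sub[of "rev (map w [0..<n])"]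
      by (elim notE, intro exI[of _ w]) (auto simp: set_eq_iff dest!: subsetD)
  qed
  then show "f -` (\<Union>n. ?F n) \<inter> A \<notin> restrict_ideal J A"
    using in_restrict_ideal_iff[OF J(1)] by simp
qed

section \<open>Tall summable ideals\<close>

lemma summable_on_nonneg_tail:
  fixes g :: "nat \<Rightarrow> real"
  assumes "g summable_on B" "\<And>n. 0 \<le> g n" "0 < \<epsilon>"
  shows "\<exists>N. \<forall>F. finite F \<longrightarrow> F \<subseteq> B \<longrightarrow> F \<inter> {..<N} = {} \<longrightarrow> sum g F < \<epsilon>"
proof -
  have "(g has_sum infsum g B) B" using assms(1) by simp
  then have "\<forall>\<^sub>F X in finite_subsets_at_top B. dist (sum g X) (infsum g B) < \<epsilon>"
    unfolding has_sum_def by (rule tendstoD) (rule assms(3))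
  then obtain X where X: "finite X" "X \<subseteq> B" "dist (sum g X) (infsum g B) < \<epsilon>"
    unfolding eventually_finite_subsets_at_top by auto
  obtain N where N: "X \<subseteq> {..<N}" using X(1) finite_nat_iff_bounded by blast
  have "sum g F < \<epsilon>" if F: "finite F" "F \<subseteq> B" "F \<inter> {..<N} = {}" for F
  proof -
    have "sum g X + sum g F = sum g (X \<union> F)"
      using F X N by (subst sum.union_disjoint) auto
    also have "\<dots> \<le> infsum g B"
      using F X assms by (intro finite_sum_le_infsum) auto
    finally show ?thesis using X(3) by (simp add: dist_real_def)
  qed
  then show ?thesis by blast
qed

text \<open>Otherwise tallness yields an infinite summable set of points of weight above
  \<open>\<epsilon>\<close>, which contradicts the smallness of tails.\<close>

lemma tall_summable_ideal_tendsto: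
  assumes "\<And>n. 0 \<le> g n" "tall (summable_ideal g)" "0 < \<epsilon>"
  shows "finite {n. \<epsilon> < g n}"
proof (rule ccontr)
  assume "infinite {n. \<epsilon> < g n}"
  then obtain Y where Y: "Y \<subseteq> {n. \<epsilon> < g n}" "infinite Y" "g summable_on Y"
    using assms(2) unfolding tall_def summable_ideal_def by blast
  obtain N where N: "\<And>F. finite F \<Longrightarrow> F \<subseteq> Y \<Longrightarrow> F \<inter> {..<N} = {} \<Longrightarrow> sum g F < \<epsilon>"
    using summable_on_nonneg_tail[OF Y(3) assms(1,3)] by blast
  obtain y where "y \<in> Y" "N \<le> y" using Y(2) infinite_nat_iff_unbounded_le by blast
  then show False using N[of "{y}"] Y(1) by auto
qed

lemma tendsto_tall_summable_ideal:
  assumes "\<And>n. 0 \<le> g n" "\<And>\<epsilon>. 0 < \<epsilon> \<Longrightarrow> finite {n. \<epsilon> < g n}"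
  shows "tall (summable_ideal g)"
  unfolding tall_def
proof (intro allI impI)
  fix X :: "nat set"
  assume "infinite X"
  have "\<exists>x\<in>X. N < x \<and> g x \<le> (1/2)^j" for N j
  proof -
    have "infinite (X - {n. (1/2)^j < g n})" using \<open>infinite X\<close> assms(2)[of "(1/2)^j"] by simp
    then obtain x where "x \<in> X - {n. (1/2)^j < g n}" "N < x"
      using infinite_nat_iff_unbounded by blast
    then show ?thesis by auto
  qed
  then obtain h where h: "\<And>N j. h N j \<in> X" "\<And>N j. N < h N j" "\<And>N j. g (h N j) \<le> (1/2)^j"
    by metis
  \<comment> \<open>Weight at most \<open>(1/2)^j\<close> at stage \<open>j\<close> makes a
    geometric series dominate.\<close>
  define y where "y = rec_nat (h 0 0) (\<lambda>j v. h v (Suc j))"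
  have y: "y j \<in> X" "y j < y (Suc j)" "g (y j) \<le> (1/2)^j" for j
    unfolding y_def using h(1,2) h(3)[of 0 0] h(3)[of _ "Suc _"] by (cases j; simp; fail)+
  have inj: "inj y" using y(2) by (simp add: strict_mono_Suc_iff strict_mono_imp_inj_on)
  have "summable (\<lambda>j. g (y j))"
    by (rule summable_comparison_test'[of "\<lambda>j. (1/2)^j" 0]) (auto simp: assms(1) y(3))
  then have "(\<lambda>j. g (y j)) summable_on UNIV"
    using assms(1) by (intro norm_summable_imp_summable_on) simp
  then have "g summable_on range y"
    using summable_on_reindex[OF inj, of g] by (simp add: o_def)
  moreover have "infinite (range y)" using inj by (simp add: finite_image_iff)
  ultimately show "\<exists>Y\<subseteq>X. infinite Y \<and> Y \<in> summable_ideal g"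
    using y(1) unfolding summable_ideal_def by blast
qed

text \<open>Player I plays the traces of a set on every second block \<open>{n (i + 1)..<n (i + 2)}\<close>,
  announcing the bound \<open>n i\<close>; the blocks grow so fast that they are disjoint from the moves of
  Player II in all such plays at once.\<close>

lemma block_sequence:
  fixes G :: "nat \<Rightarrow> 's \<Rightarrow> nat set" and nxt :: "nat \<Rightarrow> 's \<Rightarrow> nat set \<Rightarrow> 's" and s0 :: 's
  assumes fin: "\<And>k s. finite (G k s)"
  obtains n :: "nat \<Rightarrow> nat" where "n 0 = 1" "\<And>i. 2 * n i < n (Suc i)"
    and "\<And>B c st j. st 0 = s0 \<Longrightarrow>
      (\<And>j. st (Suc j) = nxt (n (c + 2 * j)) (st j) (B \<inter> {n (Suc (c + 2 * j))..<n (Suc (Suc (c + 2 * j)))})) \<Longrightarrow>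
      G (n (c + 2 * j)) (st j) \<subseteq> {..<n (Suc (c + 2 * j))}"
proof -
  \<comment> \<open>\<open>R i\<close> is a finite set containing all states relevant when
    \<open>n (Suc i)\<close> is chosen, and \<open>bd\<close> exceeds all points of
    \<open>G (n i) s\<close> for \<open>s\<close> in it. Old states are kept, since a play moves on
    only at every second index.\<close>
  define bd where "bd m R = Suc (2 * m + Max (insert 0 (\<Union>s\<in>R. G m s)))" for m R
  define stage where "stage = rec_nat (1, {s0})
    (\<lambda>_ (m, R). (bd m R, R \<union> (\<lambda>(k, s, F). nxt k s F) ` ({..bd m R} \<times> R \<times> Pow {..<bd m R})))"
  define n where "n i = fst (stage i)" for i
  define R where "R i = snd (stage i)" for i
  have n_Suc: "n (Suc i) = bd (n i) (R i)"
    and R_Suc: "R (Suc i) = R i \<union> (\<lambda>(k, s, F). nxt k s F) ` ({..n (Suc i)} \<times> R i \<times> Pow {..<n (Suc i)})" for i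
    unfolding n_def R_def stage_def by (auto simp: case_prod_beta)
  have n0: "n 0 = 1" and R0: "R 0 = {s0}" unfolding n_def R_def stage_def by auto
  have finR: "finite (R i)" for i
    by (induction i) (auto simp: R0 R_Suc)
  have s0: "s0 \<in> R i" for i
    by (induction i) (auto simp: R0 R_Suc)
  have n2: "2 * n i < n (Suc i)" for i unfolding n_Suc bd_def by simp
  have mono: "n i \<le> n (Suc i)" for i using n2[of i] by simp
  have bound: "G (n i) s \<subseteq> {..<n (Suc i)}" if "s \<in> R i" for i s
  proof
    fix x assume "x \<in> G (n i) s"
    then have "x \<le> Max (insert 0 (\<Union>s\<in>R i. G (n i) s))"
      using that finR fin by (intro Max_ge) auto
    then show "x \<in> {..<n (Suc i)}" unfolding n_Suc bd_def by simp
  qed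
  have "G (n (c + 2 * j)) (st j) \<subseteq> {..<n (Suc (c + 2 * j))}"
    if st0: "st 0 = s0"
      and st: "\<And>j. st (Suc j) = nxt (n (c + 2 * j)) (st j) (B \<inter> {n (Suc (c + 2 * j))..<n (Suc (Suc (c + 2 * j)))})"
    for B c st j
  proof -
    have "st j \<in> R (c + 2 * j)"
    proof (induction j)
      case 0
      then show ?case using s0 st0 by simp
    next
      case (Suc j)
      let ?i = "c + 2 * j"
      have "st j \<in> R (Suc ?i)" using Suc R_Suc by blast
      moreover have "n ?i \<le> n (Suc (Suc ?i))" using mono le_trans by blast
      ultimately have "st (Suc j) \<in> R (Suc (Suc ?i))"
        unfolding st R_Suc[of "Suc ?i"]
        by (intro UnI2 image_eqI[where x = "(n ?i, st j, B \<inter> {n (Suc ?i)..<n (Suc (Suc ?i))})"]) auto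
      then show ?case by simp
    qed
    then show ?thesis by (rule bound)
  qed
  then show thesis using that n0 n2 by blast
qed

text \<open>Otherwise Player II can avoid refutation forever, and \<open>f\<close> itself is a
  forbidden reduction: a set of finite weight meets almost every block in so few points that Player
  I may play them, and the digits of Player II then code a member of \<open>J\<close> covering the
  preimage.\<close>

lemma exists_winning_tree:
  assumes J: "ideal_on UNIV J" "\<And>Z. Z \<in> J \<longleftrightarrow> (\<exists>w. Z = {i. odd (w i)} \<and> (\<forall>n. Q n w))"
    and loc: "\<And>n w w'. (\<And>i. i < n \<Longrightarrow> w i = w' i) \<Longrightarrow> Q n w \<Longrightarrow> Q n w'"
    and f: "ideal_to_one J A f"
    and not_above: "\<And>S. is_summable_ideal S \<Longrightarrow> tall S \<Longrightarrow> \<not> katetov_above A (restrict_ideal J A) S"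
  shows "\<exists>t k. winning_tree (refuted Q A f) t k {} []"
proof (rule ccontr)
  assume none: "\<not> ?thesis"
  define lost where "lost k U s \<longleftrightarrow> (\<forall>t. \<not> winning_tree (refuted Q A f) t k U s)" for k U s
  have start: "lost k {} []" for k using none unfolding lost_def by blast
  have not_refuted: "\<not> refuted Q A f U s" if "lost k U s" for k U s
    using that winning_tree.Won unfolding lost_def by blast
  have "\<exists>G a. finite G \<and> (lost k U s \<longrightarrow> (\<forall>F k'. finite F \<longrightarrow> F \<inter> G = {} \<longrightarrow> card F \<le> k \<longrightarrow>
      lost k' (U \<union> F) (a # s)))" for k U s
  proof (cases "lost k U s")
    case True
    then have "\<And>t. \<not> winning_tree (refuted Q A f) t k U s" unfolding lost_def by blast
    from no_winning_tree_step[OF this] obtain G a where "finite G"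
      and "\<And>F k' t. finite F \<Longrightarrow> F \<inter> G = {} \<Longrightarrow> card F \<le> k \<Longrightarrow>
        \<not> winning_tree (refuted Q A f) t k' (U \<union> F) (a # s)" by blast
    then show ?thesis unfolding lost_def by (intro exI[of _ G] exI[of _ a]) simp
  qed auto
  then obtain G a where fin: "\<And>k U s. finite (G k U s)"
    and step: "\<And>k U s F k'. lost k U s \<Longrightarrow> finite F \<Longrightarrow> F \<inter> G k U s = {} \<Longrightarrow> card F \<le> k \<Longrightarrow>
      lost k' (U \<union> F) (a k U s # s)"
    by metis
  obtain n where n0: "n 0 = 1" and n2: "\<And>i. 2 * n i < n (Suc i)"
    and blocks: "\<And>B c st j. st 0 = ({}, []) \<Longrightarrow>
      (\<And>j. st (Suc j) = (\<lambda>k (U, s) F. (U \<union> F, a k U s # s)) (n (c + 2 * j)) (st j)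
         (B \<inter> {n (Suc (c + 2 * j))..<n (Suc (Suc (c + 2 * j)))})) \<Longrightarrow>
      (\<lambda>k (U, s). G k U s) (n (c + 2 * j)) (st j) \<subseteq> {..<n (Suc (c + 2 * j))}"
  proof (rule block_sequence[of "\<lambda>k (U, s). G k U s" "({}, [])" "\<lambda>k (U, s) F. (U \<union> F, a k U s # s)"])
    show "finite (case s of (U, s) \<Rightarrow> G k U s)" for k s using fin by (cases s) simp
  qed blast
  define blk where "blk i = {n (Suc i)..<n (Suc (Suc i))}" for i
  \<comment> \<open>In round \<open>j\<close> Player I plays
    \<open>B \<inter> blk (c + 2 * j)\<close> under the bound \<open>n (c + 2 * j)\<close>. This is
    legal because the move of Player II lies below the left end of the block, so all positions stay
    lost for Player I.\<close>
  have play: "f -` (\<Union>j. B \<inter> blk (c + 2 * j)) \<inter> A \<in> J"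
    if small: "\<And>i. card (B \<inter> blk i) \<le> n i" for B c
  proof -
    define st where "st = rec_nat ({}, [])
      (\<lambda>j (U, s). (U \<union> (B \<inter> blk (c + 2 * j)), a (n (c + 2 * j)) U s # s))"
    define U where "U j = fst (st j)" for j
    define s where "s j = snd (st j)" for j
    define w where "w j = a (n (c + 2 * j)) (U j) (s j)" for j
    have st0: "U 0 = {}" "s 0 = []" unfolding U_def s_def st_def by auto
    have stS: "U (Suc j) = U j \<union> (B \<inter> blk (c + 2 * j))" "s (Suc j) = w j # s j" for j
      unfolding U_def s_def w_def st_def by (auto simp: case_prod_beta)
    have G: "G (n (c + 2 * j)) (U j) (s j) \<subseteq> {..<n (Suc (c + 2 * j))}" for j
      using blocks[of st c B j] unfolding U_def s_def by (simp add: st_def blk_def case_prod_beta)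
    have lost: "lost (n (c + 2 * j)) (U j) (s j)" for j
    proof (induction j)
      case 0
      then show ?case using start st0 by simp
    next
      case (Suc j)
      have "finite (B \<inter> blk (c + 2 * j))" unfolding blk_def by simp
      moreover have "B \<inter> blk (c + 2 * j) \<inter> G (n (c + 2 * j)) (U j) (s j) = {}"
        using G[of j] unfolding blk_def by auto
      ultimately show ?case
        using step[OF Suc, where F = "B \<inter> blk (c + 2 * j)"] small unfolding stS w_def by blast
    qed
    have s: "s j = rev (map w [0..<j])" for j by (induction j) (simp_all add: st0 stS)
    have wit: "\<exists>w'. (\<forall>i<j. w i = w' i) \<and> (\<forall>m\<le>j. Q m w') \<and> (\<forall>i<j. i \<in> A \<longrightarrow> f i \<in> U j \<longrightarrow> odd (w' i))" for j
    proof -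
      obtain w' where "\<forall>i<length (s j). rev (s j) ! i = w' i" "\<forall>m\<le>length (s j). Q m w'"
        "\<forall>i<length (s j). i \<in> A \<longrightarrow> f i \<in> U j \<longrightarrow> odd (w' i)"
        using not_refuted[OF lost[of j]] unfolding refuted_def not_not by (elim exE conjE)
      then show ?thesis unfolding s by (intro exI[of _ w']) simp
    qed
    have "Q m w" for m
    proof -
      obtain w' where "\<forall>i<m. w i = w' i" "\<forall>m'\<le>m. Q m' w'"
        using wit[of m] by (elim exE conjE)
      then show ?thesis using loc[of m w' w] by simp
    qed
    then have "{i. odd (w i)} \<in> J" using J(2) by blast
    moreover have "f -` (\<Union>j. B \<inter> blk (c + 2 * j)) \<inter> A \<subseteq> {i. odd (w i)}"
    proof
      fix i assume "i \<in> f -` (\<Union>j. B \<inter> blk (c + 2 * j)) \<inter> A"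
      then obtain j where "i \<in> A" and j: "f i \<in> B \<inter> blk (c + 2 * j)" by auto
      have "mono U" by (intro incseq_SucI) (simp add: stS)
      then have "U (Suc j) \<subseteq> U (Suc (max i j))" by (intro monoD[OF \<open>mono U\<close>]) auto
      then have "f i \<in> U (Suc (max i j))" using j stS(1)[of j] by blast
      \<comment> \<open>At stage \<open>Suc (max i j)\<close> digit \<open>i\<close> is on record
        and the \<open>j\<close>-th set has been played.\<close>
      then show "i \<in> {i. odd (w i)}" using wit[of "Suc (max i j)"] \<open>i \<in> A\<close>
        by (auto simp: less_Suc_eq_le)
    qed
    ultimately show ?thesis using ideal_on_subset[OF J(1)] by blast
  qed
  have "n i < n (Suc i)" for i using n2[of i] by simp
  then have smono: "strict_mono n" by (simp add: strict_mono_Suc_iff)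
  have pos: "0 < n i" for i using strict_mono_less_eq[OF smono, of 0 i] n0 by simp
  have blocks_cover: "\<exists>i. m \<in> blk i" if "n 1 \<le> m" for m
  proof -
    have "m < n (Suc m)" using strict_mono_imp_increasing[OF smono, of "Suc m"] by simp
    moreover have "\<not> m < n (Suc 0)" using that by simp
    ultimately obtain k where "\<not> m < n (Suc k)" "m < n (Suc (Suc k))"
      using ex_least_nat_less[of "\<lambda>k. m < n (Suc k)" m] by auto
    then show ?thesis unfolding blk_def by (intro exI[of _ k]) simp
  qed
  have blk_unique: "i = i'" if "m \<in> blk i" "m \<in> blk i'" for m i i'
  proof -
    have "n (Suc i) < n (Suc (Suc i'))" "n (Suc i') < n (Suc (Suc i))"
      using that unfolding blk_def by auto
    then show ?thesis using smono by (simp add: strict_mono_less)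
  qed
  \<comment> \<open>With weight \<open>1 / n i\<close> on \<open>blk i\<close>, total weight below 1
    on the block means fewer than \<open>n i\<close> points. The value 1 below \<open>n 1\<close>
    affects only finitely many points.\<close>
  define g where "g m = (if m < n 1 then 1 else 1 / real (n (SOME i. m \<in> blk i)))" for m
  have g: "g m = 1 / real (n i)" if "m \<in> blk i" for m i
  proof -
    have "(SOME i. m \<in> blk i) = i" using that blk_unique by (metis someI)
    moreover have "n 1 \<le> m" using that strict_mono_less_eq[OF smono, of 1 "Suc i"] unfolding blk_def by simp
    ultimately show ?thesis unfolding g_def by simp
  qed
  have g0: "0 \<le> g m" for m unfolding g_def by simp
  have tail: "\<exists>N. \<forall>i\<ge>N. card (B \<inter> blk i) < n i" if sB: "g summable_on B" for B
  proof -
    obtain N where N: "\<And>F. finite F \<Longrightarrow> F \<subseteq> B \<Longrightarrow> F \<inter> {..<N} = {} \<Longrightarrow> sum g F < 1"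
      using summable_on_nonneg_tail[OF sB g0, of 1] by auto
    have "card (B \<inter> blk i) < n i" if "i \<ge> N" for i
    proof -
      have "N \<le> n (Suc i)" using strict_mono_imp_increasing[OF smono, of "Suc i"] that by simp
      then have "sum g (B \<inter> blk i) < 1" by (intro N) (auto simp: blk_def)
      moreover have "sum g (B \<inter> blk i) = (\<Sum>m\<in>B \<inter> blk i. 1 / real (n i))"
        by (intro sum.cong) (auto simp: g)
      ultimately show ?thesis using pos[of i] by (simp add: field_simps)
    qed
    then show ?thesis by blast
  qed
  have "\<not> g summable_on UNIV"
  proof
    assume "g summable_on UNIV"
    then obtain i where "card (blk i) < n i" using tail[of UNIV] by auto
    \<comment> \<open>\<open>blk i\<close> has more than \<open>n (Suc i)\<close> points because
      \<open>2 * n (Suc i) < n (Suc (Suc i))\<close>.\<close>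
    then show False unfolding blk_def using n2[of "Suc i"] n2[of i] by simp
  qed
  then have "is_summable_ideal (summable_ideal g)" unfolding is_summable_ideal_def using g0 by blast
  moreover have "tall (summable_ideal g)"
  proof (rule tendsto_tall_summable_ideal[OF g0])
    fix \<epsilon> :: real
    assume "0 < \<epsilon>"
    then obtain k :: nat where k: "1 / real (Suc k) < \<epsilon>" using reals_Archimedean[OF \<open>0 < \<epsilon>\<close>] by (auto simp: inverse_eq_divide)
    have "m < n (Suc (Suc k))" if "\<epsilon> < g m" for m
    proof (rule ccontr)
      assume m: "\<not> m < n (Suc (Suc k))"
      then have "n 1 \<le> m" using strict_mono_less_eq[OF smono, of 1 "Suc (Suc k)"] by simp
      then obtain i where i: "m \<in> blk i" using blocks_cover by blast
      then have "m < n (Suc (Suc i))" unfolding blk_def by simp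
      then have "n (Suc (Suc k)) < n (Suc (Suc i))" using m by simp
      then have "Suc k \<le> i" using smono by (simp add: strict_mono_less)
      then have "Suc k \<le> n i" using strict_mono_imp_increasing[OF smono, of i] by simp
      then have "1 / real (n i) \<le> 1 / real (Suc k)" by (intro divide_left_mono) auto
      then show False using k that g[OF i] by simp
    qed
    then have "{m. \<epsilon> < g m} \<subseteq> {..<n (Suc (Suc k))}" by blast
    then show "finite {m. \<epsilon> < g m}" using finite_subset by blast
  qed
  moreover have "katetov_above A (restrict_ideal J A) (summable_ideal g)"
    unfolding katetov_above_def
  proof (intro exI[of _ f] ballI)
    fix B assume "B \<in> summable_ideal g"
    then have "g summable_on B" unfolding summable_ideal_def by simp
    then obtain N where N: "\<And>i. i \<ge> N \<Longrightarrow> card (B \<inter> blk i) < n i" using tail by blast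
    \<comment> \<open>Removing finitely many points extends the cardinality bound to all blocks; the
      preimage of the removed part is in \<open>J\<close> because \<open>f\<close> is
      \<open>J\<close>-to-one.\<close>
    define B' where "B' = B - {..<n (Suc N)}"
    have "card (B' \<inter> blk i) \<le> n i" for i
    proof (cases "i \<ge> N")
      case True
      have "card (B' \<inter> blk i) \<le> card (B \<inter> blk i)"
        unfolding B'_def blk_def by (intro card_mono) auto
      then show ?thesis using N[OF True] by simp
    next
      case False
      then have "n (Suc (Suc i)) \<le> n (Suc N)" using smono by (simp add: strict_mono_less_eq)
      then have "B' \<inter> blk i = {}" unfolding B'_def blk_def by auto
      then show ?thesis by simp
    qed
    then have *: "f -` (\<Union>j. B' \<inter> blk (c + 2 * j)) \<inter> A \<in> J" for c by (rule play)
    have small: "f -` F \<inter> A \<in> J" if "finite F" for F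
      using that
    proof induction
      case empty
      then show ?case using ideal_on_finite[OF J(1)] by simp
    next
      case (insert x F)
      have "f -` insert x F \<inter> A = (f -` {x} \<inter> A) \<union> (f -` F \<inter> A)" by auto
      then show ?case using insert f ideal_on_Un[OF J(1)] unfolding ideal_to_one_def by simp
    qed
    \<comment> \<open>One play uses only every second block, so even and odd blocks are handled by
      two plays, \<open>c = 0\<close> and \<open>c = 1\<close>.\<close>
    have "B \<subseteq> {..<n (Suc N)} \<union> (\<Union>j. B' \<inter> blk (0 + 2 * j)) \<union> (\<Union>j. B' \<inter> blk (1 + 2 * j))"
    proof
      fix m assume "m \<in> B"
      show "m \<in> {..<n (Suc N)} \<union> (\<Union>j. B' \<inter> blk (0 + 2 * j)) \<union> (\<Union>j. B' \<inter> blk (1 + 2 * j))"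
      proof (cases "m < n (Suc N)")
        case False
        then have "m \<in> B'" using \<open>m \<in> B\<close> unfolding B'_def by simp
        have "n 1 \<le> m" using False strict_mono_less_eq[OF smono, of 1 "Suc N"] by simp
        then obtain i where "m \<in> blk i" using blocks_cover by blast
        moreover have "i = 0 + 2 * (i div 2) \<or> i = 1 + 2 * (i div 2)" by presburger
        ultimately show ?thesis using \<open>m \<in> B'\<close> by (metis IntI UN_I UNIV_I UnCI)
      qed simp
    qed
    then have "f -` B \<inter> A \<subseteq> (f -` {..<n (Suc N)} \<inter> A) \<union> (f -` (\<Union>j. B' \<inter> blk (0 + 2 * j)) \<inter> A) \<union>
        (f -` (\<Union>j. B' \<inter> blk (1 + 2 * j)) \<inter> A)"
      unfolding Int_Un_distrib2[symmetric] vimage_Un[symmetric] by (intro Int_mono vimage_mono) simp_all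
    moreover have "\<dots> \<in> J" by (intro ideal_on_Un[OF J(1)] * small) simp
    ultimately have "f -` B \<inter> A \<in> J" by (rule ideal_on_subset[OF J(1), rotated])
    then show "f -` B \<inter> A \<in> restrict_ideal J A" using in_restrict_ideal_iff[OF J(1)] by simp
  qed
  ultimately show False using not_above by blast
qed

section \<open>The game for Borel ideals\<close>

lemma Borel_I_wins_all_games:
  assumes "ideal_on UNIV J" "borel_family J"
    and "\<And>A S. A \<notin> J \<Longrightarrow> is_summable_ideal S \<Longrightarrow> tall S \<Longrightarrow>
      \<not> katetov_above A (restrict_ideal J A) S"
  shows "I_wins_all_games J"
  unfolding I_wins_all_games_def
proof (intro allI impI)
  fix A f
  assume "A \<notin> J" "ideal_to_one J A f"
  from borel_family_witnesses[OF assms(2)] show "\<exists>s. winning_strategy_I J A f s"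
  proof (elim exE conjE)
    fix Q :: "nat \<Rightarrow> (nat \<Rightarrow> nat) \<Rightarrow> bool"
    assume loc: "\<forall>n w w'. (\<forall>i<n. w i = w' i) \<longrightarrow> Q n w \<longrightarrow> Q n w'"
      and J: "\<forall>Z. Z \<in> J \<longleftrightarrow> (\<exists>w. Z = {i. odd (w i)} \<and> (\<forall>n. Q n w))"
    have "\<exists>t k. winning_tree (refuted Q A f) t k {} []"
      by (rule exists_winning_tree[OF assms(1) J[rule_format] loc[rule_format]
            \<open>ideal_to_one J A f\<close> assms(3)[OF \<open>A \<notin> J\<close>]])
    then obtain t k where "winning_tree (refuted Q A f) t k {} []" by (elim exE)
    from simulation_wins[OF assms(1) J[rule_format] this] show ?thesis ..
  qed
qed

section \<open>Generic members of a summable ideal\<close>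

text \<open>For large \<open>n\<close>, every given interval contains a full period of
  \<open>frac (2 ^ n * r)\<close>, hence an open subinterval on which the digit is
  \<open>Suc (\<phi> n)\<close>.\<close>

lemma nowhere_dense_avoid_digits:
  fixes \<phi> :: "nat \<Rightarrow> nat"
  shows "nowhere_dense {r::real. \<forall>n. nat \<lfloor>1 / frac (2 ^ n * r)\<rfloor> \<noteq> Suc (\<phi> n)}" (is "nowhere_dense ?S")
  unfolding nowhere_dense_def
proof (rule ccontr)
  assume "interior (closure ?S) \<noteq> {}"
  then obtain x where "x \<in> interior (closure ?S)" by blast
  then obtain e where "0 < e" and e: "ball x e \<subseteq> closure ?S" unfolding mem_interior by blast
  obtain n where n: "2 / e < 2 ^ n" using real_arch_pow[of 2 "2 / e"] by auto
  define j where "j = \<lceil>2 ^ n * x\<rceil>"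
  define m where "m = \<phi> n"
  have j: "2 ^ n * x \<le> of_int j" "of_int j < 2 ^ n * x + 1" unfolding j_def by linarith+
  \<comment> \<open>On \<open>T\<close> the reciprocal of the fractional part lies between
    \<open>m + 1\<close> and \<open>m + 2\<close>. The choices of \<open>n\<close> and
    \<open>j\<close> place \<open>T\<close> between \<open>x\<close> and
    \<open>x + e\<close>.\<close>
  define T where "T = {(of_int j + 1 / (real m + 2)) / 2 ^ n <..< (of_int j + 1 / (real m + 1)) / 2 ^ n}"
  have small: "1 / (real m + 1) \<le> 1" "1 / (real m + 2) < 1 / (real m + 1)" "0 < 1 / (real m + 2)"
    by (simp_all add: field_simps)
  have "r \<in> ball x e" if "r \<in> T" for r
  proof -
    have r: "of_int j + 1 / (real m + 2) < 2 ^ n * r" "2 ^ n * r < of_int j + 1 / (real m + 1)"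
      using that unfolding T_def by (simp_all add: pos_divide_less_eq pos_less_divide_eq mult.commute)
    then have "2 ^ n * x < 2 ^ n * r" "2 ^ n * r < 2 ^ n * x + 2" using j small by linarith+
    moreover have "2 < 2 ^ n * e" using n \<open>0 < e\<close> by (simp add: field_simps)
    ultimately have "2 ^ n * x < 2 ^ n * r" "2 ^ n * r < 2 ^ n * (x + e)" by (simp_all add: distrib_left)
    then show ?thesis by (simp add: dist_real_def)
  qed
  then have "T \<subseteq> closure ?S" using e by blast
  moreover have "T \<inter> ?S = {}"
  proof -
    have "nat \<lfloor>1 / frac (2 ^ n * r)\<rfloor> = Suc (\<phi> n)" if "r \<in> T" for r
    proof -
      have r: "of_int j + 1 / (real m + 2) < 2 ^ n * r" "2 ^ n * r < of_int j + 1 / (real m + 1)"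
        using that unfolding T_def by (simp_all add: pos_divide_less_eq pos_less_divide_eq mult.commute)
      then have "frac (2 ^ n * r) = 2 ^ n * r - of_int j"
        unfolding frac_unique_iff using small by (intro conjI) (simp, linarith+)
      then have f: "1 / (real m + 2) < frac (2 ^ n * r)" "frac (2 ^ n * r) < 1 / (real m + 1)"
        using r by linarith+
      then have "0 < frac (2 ^ n * r)" using small(3) by linarith
      then have "real m + 1 < 1 / frac (2 ^ n * r)" "1 / frac (2 ^ n * r) < real m + 2"
        using f by (simp_all add: field_simps)
      then have "\<lfloor>1 / frac (2 ^ n * r)\<rfloor> = int m + 1" by (intro floor_unique) auto
      then show ?thesis unfolding m_def by simp
    qed
    then show ?thesis by blast
  qed
  then have "T \<inter> closure ?S = {}" unfolding T_def by (intro open_Int_closure_eq_empty[THEN iffD2]) auto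
  ultimately have "T = {}" by blast
  moreover have "(of_int j + 1 / (real m + 2)) / 2 ^ n < (of_int j + 1 / (real m + 1)) / 2 ^ n"
    using small(2) by (intro divide_strict_right_mono) auto
  then have "T \<noteq> {}" unfolding T_def by simp
  ultimately show False by blast
qed

text \<open>Baire category; it serves to show that a family witnessing a value of \<open>fip\<close>
  is infinite.\<close>

lemma countable_meager_Union_not_UNIV:
  fixes \<C> :: "real set set"
  assumes "countable \<C>" "\<And>M. M \<in> \<C> \<Longrightarrow> meager M"
  shows "\<Union>\<C> \<noteq> UNIV"
proof -
  obtain N :: "real set \<Rightarrow> nat \<Rightarrow> real set" where N: "\<And>M n. M \<in> \<C> \<Longrightarrow> nowhere_dense (N M n)"
    "\<And>M. M \<in> \<C> \<Longrightarrow> M = (\<Union>n. N M n)"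
    using assms(2) unfolding meager_def by metis
  define \<G> where "\<G> = (\<lambda>(M, n). - closure (N M n)) ` (\<C> \<times> UNIV)"
  have "UNIV \<subseteq> closure (\<Inter>\<G>)"
  proof (rule Baire)
    show "countable \<G>" unfolding \<G>_def using assms(1) by simp
    fix T assume "T \<in> \<G>"
    then obtain M n where "M \<in> \<C>" "T = - closure (N M n)" unfolding \<G>_def by auto
    then show "openin (top_of_set UNIV) T \<and> UNIV \<subseteq> closure T"
      using N(1)[of M n] unfolding nowhere_dense_def by (simp add: closure_complement open_Compl)
  qed simp
  then have "\<Inter>\<G> \<noteq> {}" by (metis UNIV_not_empty closure_empty subset_empty)
  then obtain x where x: "x \<in> \<Inter>\<G>" by blast
  have "x \<notin> N M n" if "M \<in> \<C>" for M n
  proof -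
    have "- closure (N M n) \<in> \<G>" using that unfolding \<G>_def by force
    then show ?thesis using x closure_subset[of "N M n"] by blast
  qed
  then show ?thesis using N(2) by blast
qed

text \<open>The digit is at least 1 unless the fractional part is 0, so its predecessor ranges over
  the codes of finite sets. Sets that are too heavy become empty, which keeps the union of all
  blocks summable.\<close>

definition block :: "(nat \<Rightarrow> real) \<Rightarrow> nat \<Rightarrow> real \<Rightarrow> nat set" where
  "block g n r = (let H = set_decode (nat \<lfloor>1 / frac (2 ^ n * r)\<rfloor> - 1) in
     if sum g H \<le> (1/2) ^ n then H else {})"

lemma sum_block: "sum g (block g n r) \<le> (1/2) ^ n"
  by (simp add: block_def Let_def)

text \<open>The weight bound ensures that \<open>block\<close> does not replace the coded set
  \<open>\<phi> n\<close> by the empty set.\<close>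

lemma nowhere_dense_avoid_blocks:
  assumes "\<And>n. finite (\<phi> n)" "\<And>n. sum g (\<phi> n) \<le> (1/2) ^ n"
  shows "nowhere_dense {r. \<forall>n. block g n r \<noteq> \<phi> n}"
proof -
  have "block g n r = \<phi> n" if "nat \<lfloor>1 / frac (2 ^ n * r)\<rfloor> = Suc (set_encode (\<phi> n))" for n r
    using assms that by (simp add: block_def Let_def)
  then have "{r. \<forall>n. block g n r \<noteq> \<phi> n} \<subseteq>
      {r. \<forall>n. nat \<lfloor>1 / frac (2 ^ n * r)\<rfloor> \<noteq> Suc (set_encode (\<phi> n))}"
    by blast
  from interior_mono[OF closure_mono[OF this]] show ?thesis
    using nowhere_dense_avoid_digits[of "\<lambda>n. set_encode (\<phi> n)"]
    unfolding nowhere_dense_def by simp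
qed

lemma summable_on_blocks:
  assumes "\<And>n. 0 \<le> g n"
  shows "g summable_on (\<Union>n. block g n r)"
proof (rule nonneg_bdd_above_summable_on)
  have fin: "finite (block g n r)" for n by (simp add: block_def Let_def)
  have le: "sum g (\<Union>n<N. block g n r) \<le> 2 - 2 * (1/2) ^ N" for N
  proof (induction N)
    case (Suc N)
    have "sum g (\<Union>n<Suc N. block g n r) = sum g ((\<Union>n<N. block g n r) \<union> block g N r)"
      by (simp add: lessThan_Suc Un_commute)
    also have "\<dots> \<le> sum g (\<Union>n<N. block g n r) + sum g (block g N r)"
      using fin assms by (subst sum.union_inter[symmetric]) (auto intro!: sum_nonneg)
    also have "\<dots> \<le> 2 - 2 * (1/2) ^ N + (1/2) ^ N"
      using Suc sum_block by (rule add_mono)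
    finally show ?case by simp
  qed simp
  show "bdd_above (sum g ` {F. F \<subseteq> (\<Union>n. block g n r) \<and> finite F})"
  proof (rule bdd_aboveI2)
    fix F assume "F \<in> {F. F \<subseteq> (\<Union>n. block g n r) \<and> finite F}"
    then have F: "F \<subseteq> (\<Union>n. block g n r)" "finite F" by auto
    then obtain X where X: "finite X" "F \<subseteq> (\<Union>n\<in>X. block g n r)"
      using finite_subset_Union[OF F(2), of "range (\<lambda>n. block g n r)"] 
      by (metis finite_subset_image)
    then obtain N where "X \<subseteq> {..<N}" using finite_nat_iff_bounded by blast
    then have "F \<subseteq> (\<Union>n<N. block g n r)" using X(2) by blast
    then have "sum g F \<le> sum g (\<Union>n<N. block g n r)"
      using fin assms by (intro sum_mono2) auto
    also have "\<dots> \<le> 2 - 2 * (1/2) ^ N" by (rule le)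
    also have "\<dots> \<le> 2" by simp
    finally show "sum g F \<le> 2" .
  qed
qed (use assms in auto)

text \<open>Threshold moves force every response of Player I to have weight at most \<open>(1/2) ^ n\<close>, where
  \<open>n\<close> can be chosen freely; so the response may occur as the \<open>n\<close>-th block of a real number.\<close>

definition threshold :: "(nat \<Rightarrow> real) \<Rightarrow> nat \<Rightarrow> nat \<Rightarrow> nat set" where
  "threshold g k n = {m. (1/2) ^ n < real k * g m}"

lemma finite_threshold:
  assumes "\<And>\<epsilon>. 0 < \<epsilon> \<Longrightarrow> finite {n. \<epsilon> < g n}"
  shows "finite (threshold g k n)"
proof (cases "k = 0")
  case False
  then have "threshold g k n = {m. (1/2) ^ n / real k < g m}"
    unfolding threshold_def by (simp add: field_simps)
  then show ?thesis using assms[of "(1/2) ^ n / real k"] False by simp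
qed (simp add: threshold_def)

lemma sum_avoid_threshold:
  assumes "finite F" "F \<inter> threshold g k n = {}" "card F \<le> k"
  shows "sum g F \<le> (1/2) ^ n"
proof (cases "k = 0")
  case True
  then have "F = {}" using assms by simp
  then show ?thesis by simp
next
  case False
  have "g m \<le> (1/2) ^ n / real k" if "m \<in> F" for m
  proof -
    have "m \<notin> threshold g k n" using assms(2) that by blast
    then show ?thesis using False unfolding threshold_def by (simp add: field_simps)
  qed
  then have "sum g F \<le> real (card F) * ((1/2) ^ n / real k)" by (rule sum_bounded_above)
  also have "\<dots> \<le> real k * ((1/2) ^ n / real k)" using assms(3) by (intro mult_right_mono) auto
  finally show ?thesis using False by simp
qed

section \<open>Generic reals against a winning strategy\<close>

definition next_bound :: "strategy \<Rightarrow> nat set list \<Rightarrow> nat" where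
  "next_bound s L = (if L = [] then fst s else snd (snd s L))"

text \<open>The exponents are listed with the latest first, the resulting moves with the earliest
  first, as a strategy reads them.\<close>

primrec threshold_moves :: "(nat \<Rightarrow> real) \<Rightarrow> strategy \<Rightarrow> nat list \<Rightarrow> nat set list" where
  "threshold_moves g s [] = []"
| "threshold_moves g s (n # \<nu>) = threshold_moves g s \<nu> @
     [threshold g (next_bound s (threshold_moves g s \<nu>)) n]"

lemma length_threshold_moves [simp]: "length (threshold_moves g s \<nu>) = length \<nu>"
  by (induction \<nu>) auto

lemma finite_threshold_moves:
  assumes "\<And>\<epsilon>. 0 < \<epsilon> \<Longrightarrow> finite {n. \<epsilon> < g n}" "X \<in> set (threshold_moves g s \<nu>)"
  shows "finite X"
  using assms(2) by (induction \<nu>) (auto simp: finite_threshold[OF assms(1)])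

lemma play_k_next_bound: "play_k s G n = next_bound s (map G [0..<n])"
  by (cases n) (simp_all add: next_bound_def)

lemma response_threshold_moves:
  assumes s: "winning_strategy_I J A f s"
    and g: "\<And>\<epsilon>. 0 < \<epsilon> \<Longrightarrow> finite {n. \<epsilon> < g n}"
  shows "finite (fst (snd s (threshold_moves g s (n # \<nu>)))) \<and>
    sum g (fst (snd s (threshold_moves g s (n # \<nu>)))) \<le> (1/2) ^ n"
proof -
  let ?L = "threshold_moves g s (n # \<nu>)" and ?L' = "threshold_moves g s \<nu>"
  \<comment> \<open>Legality is given for infinite plays, so the finite list is continued by empty
    moves.\<close>
  define G where "G i = (if i < length ?L then ?L ! i else {})" for i
  have "finite (G i)" for i
    using finite_threshold_moves[OF g nth_mem, of i s "n # \<nu>"] unfolding G_def by auto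
  then have legal: "finite (play_F s G m) \<and> play_F s G m \<inter> G m = {} \<and> card (play_F s G m) \<le> play_k s G m" for m
    using s unfolding winning_strategy_I_def by blast
  have L: "map G [0..<Suc (length \<nu>)] = ?L"
    by (rule nth_equalityI) (auto simp: G_def simp del: upt_Suc)
  have L': "map G [0..<length \<nu>] = ?L'"
    by (rule nth_equalityI) (auto simp: G_def nth_append)
  have "play_F s G (length \<nu>) = fst (snd s ?L)" unfolding play_F_def L ..
  moreover have "play_k s G (length \<nu>) = next_bound s ?L'" unfolding play_k_next_bound L' ..
  moreover have "G (length \<nu>) = threshold g (next_bound s ?L') n"
    unfolding G_def by (simp add: nth_append)
  ultimately show ?thesis using legal[of "length \<nu>"] sum_avoid_threshold by metis
qed

text \<open>For each of the countably many threshold histories \<open>\<nu>\<close>, the reals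
  having no \<open>n\<close>-th block equal to the response to threshold \<open>n\<close> form a
  nowhere dense set. \<open>M\<close> is the union of these sets.\<close>

lemma meager_if_I_wins:
  assumes J: "ideal_on UNIV J" and s: "winning_strategy_I J A f s"
    and g: "\<And>\<epsilon>. 0 < \<epsilon> \<Longrightarrow> finite {n. \<epsilon> < g n}"
  shows "\<exists>M. meager M \<and> (\<forall>r. f -` (\<Union>n. block g n r) \<inter> A \<in> J \<longrightarrow> r \<in> M)"
proof -
  define \<phi> where "\<phi> \<nu> n = fst (snd s (threshold_moves g s (n # \<nu>)))" for \<nu> n
  define M where "M = (\<Union>i. {r. \<forall>n. block g n r \<noteq> \<phi> (list_decode i) n})"
  have "meager M"
    unfolding meager_def M_def \<phi>_def
    using response_threshold_moves[OF s g]
    by (intro exI[of _ "\<lambda>i. {r. \<forall>n. block g n r \<noteq> \<phi> (list_decode i) n}"] conjI allI)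
      (auto intro!: nowhere_dense_avoid_blocks simp: \<phi>_def)
  moreover have "f -` (\<Union>n. block g n r) \<inter> A \<notin> J" if "r \<notin> M" for r
  proof -
    have "\<exists>n. block g n r = \<phi> \<nu> n" for \<nu>
    proof -
      have "\<exists>n. block g n r = \<phi> (list_decode (list_encode \<nu>)) n"
        using that unfolding M_def by blast
      then show ?thesis by simp
    qed
    then obtain h where h: "\<And>\<nu>. block g (h \<nu>) r = \<phi> \<nu> (h \<nu>)" by metis
    \<comment> \<open>Starting from the empty history and following \<open>h\<close> gives an
      infinite play in which all responses are blocks of \<open>r\<close>.\<close>
    define \<nu> where "\<nu> = rec_nat [] (\<lambda>_ \<nu>. h \<nu> # \<nu>)"
    have \<nu>: "\<nu> 0 = []" "\<nu> (Suc j) = h (\<nu> j) # \<nu> j" for j unfolding \<nu>_def by simp_all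
    define G where "G j = threshold g (next_bound s (threshold_moves g s (\<nu> j))) (h (\<nu> j))" for j
    have "finite (G j)" for j unfolding G_def by (rule finite_threshold[OF g])
    then have win: "f -` (\<Union>n. play_F s G n) \<inter> A \<notin> J"
      using s in_restrict_ideal_iff[OF J] unfolding winning_strategy_I_def by auto
    have moves: "map G [0..<j] = threshold_moves g s (\<nu> j)" for j
      by (induction j) (simp_all add: \<nu> G_def)
    have "play_F s G j = block g (h (\<nu> j)) r" for j
      unfolding play_F_def moves h \<phi>_def \<nu> ..
    then have "f -` (\<Union>n. play_F s G n) \<inter> A \<subseteq> f -` (\<Union>n. block g n r) \<inter> A" by auto
    then show ?thesis using win ideal_on_subset[OF J] by blast
  qed
  ultimately show ?thesis by blast
qed

section \<open>The covering number and the finite intersection property\<close>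

definition finite_inters :: "'a set set \<Rightarrow> 'a set set" where
  "finite_inters \<A> = {\<Inter>F | F. F \<subseteq> \<A> \<and> finite F}"

lemma finite_inters_Int: "A \<in> finite_inters \<A> \<Longrightarrow> B \<in> finite_inters \<A> \<Longrightarrow> A \<inter> B \<in> finite_inters \<A>"
  unfolding finite_inters_def
  by clarify (metis Inter_Un_distrib Un_least finite_UnI)

lemma card_of_finite_inters:
  fixes \<A> :: "'a set set"
  assumes "infinite \<A>"
  shows "|finite_inters \<A>| \<le>o |\<A>|"
proof -
  \<comment> \<open>\<open>L n\<close> consists of the intersections of \<open>n\<close> members,
    repetitions allowed.\<close>
  define L where "L = rec_nat {UNIV} (\<lambda>_ X. (\<lambda>(A, B). A \<inter> B) ` (\<A> \<times> X))"
  have L: "L 0 = {UNIV}" "L (Suc n) = (\<lambda>(A, B). A \<inter> B) ` (\<A> \<times> L n)" for n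
    unfolding L_def by simp_all
  have "|L n| \<le>o |\<A>|" for n
  proof (induction n)
    case 0
    have "\<A> \<noteq> {}" using assms by auto
    then show ?case unfolding L by (rule card_of_singl_ordLeq)
  next
    case (Suc n)
    have "|\<A> \<times> L n| \<le>o |\<A>|"
      using Suc by (intro card_of_Sigma_ordLeq_infinite[OF assms card_of_mono1]) auto
    then show ?case unfolding L(2) using card_of_image ordLeq_transitive by blast
  qed
  then have "|\<Union>n. L n| \<le>o |\<A>|"
    using assms by (intro card_of_UNION_ordLeq_infinite) (auto simp: infinite_iff_card_of_nat)
  moreover have "\<Inter>F \<in> (\<Union>n. L n)" if "finite F" "F \<subseteq> \<A>" for F
    using that
  proof induction
    case empty
    have "\<Inter>{} \<in> L 0" unfolding L by simp
    then show ?case by blast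
  next
    case (insert A F)
    then obtain n where "\<Inter>F \<in> L n" by blast
    then have "\<Inter>(insert A F) \<in> L (Suc n)" unfolding L using insert by force
    then show ?case by blast
  qed
  then have "finite_inters \<A> \<subseteq> (\<Union>n. L n)" unfolding finite_inters_def by blast
  ultimately show ?thesis using card_of_mono1 ordLeq_transitive by blast
qed

lemma cov_meager_le:
  fixes \<C> :: "real set set"
  assumes "\<And>M. M \<in> \<C> \<Longrightarrow> meager M" "\<Union>\<C> = UNIV"
  shows "cov_meager \<le>o |\<C>|"
  unfolding cov_meager_def
  by (rule min_card_le[OF cov_meager_cards_nonempty Card_order_cov_meager_cards])
    (use assms in \<open>auto simp: cov_meager_cards_def\<close>)

lemma cov_meager_le_witness:
  assumes I: "ideal_on UNIV I" and J: "ideal_on UNIV J"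
    and g: "\<And>n. 0 \<le> g n" "tall (summable_ideal g)" "summable_ideal g \<subseteq> I"
    and wins: "I_wins_all_games J"
    and \<A>: "has_FIP J \<A>" and f: "\<And>B. B \<in> I \<Longrightarrow> \<not> has_FIP J (\<A> \<union> {f -` B})"
  shows "cov_meager \<le>o |\<A>|"
proof -
  have lim: "finite {n. \<epsilon> < g n}" if "0 < \<epsilon>" for \<epsilon>
    using tall_summable_ideal_tendsto[OF g(1,2) that] .
  have pos: "A \<notin> J" if "A \<in> finite_inters \<A>" for A
    using that \<A> unfolding has_FIP_def finite_inters_def by blast
  have small: "\<exists>A\<in>finite_inters \<A>. f -` B \<inter> A \<in> J" if B: "B \<in> I" for B
  proof -
    obtain F where F: "F \<subseteq> \<A> \<union> {f -` B}" "finite F" "\<Inter>F \<in> J"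
      using f[OF B] unfolding has_FIP_def by blast
    \<comment> \<open>Splitting off the new set leaves a finite intersection from
      \<open>\<A>\<close> alone.\<close>
    have "f -` B \<inter> \<Inter>(F - {f -` B}) \<subseteq> \<Inter>F" by blast
    then have "f -` B \<inter> \<Inter>(F - {f -` B}) \<in> J" using F(3) ideal_on_subset[OF J] by blast
    moreover have "\<Inter>(F - {f -` B}) \<in> finite_inters \<A>"
      unfolding finite_inters_def using F by blast
    ultimately show ?thesis by blast
  qed
  \<comment> \<open>If \<open>f\<close> is \<open>J\<close>-to-one on some \<open>A0\<close>, Player
    I wins on \<open>A \<inter> A0\<close>. Otherwise infinitely many single fibres are positive on
    \<open>A\<close>, and it suffices that some block of \<open>r\<close> is one suitable
    singleton.\<close>
  have "\<exists>M. meager M \<and> (\<forall>r. f -` (\<Union>n. block g n r) \<inter> A \<in> J \<longrightarrow> r \<in> M)"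
    if A: "A \<in> finite_inters \<A>" for A
  proof (cases "\<exists>A0\<in>finite_inters \<A>. ideal_to_one J A0 f")
    case True
    then obtain A0 where A0: "A0 \<in> finite_inters \<A>" "ideal_to_one J A0 f" by blast
    have "ideal_to_one J (A \<inter> A0) f"
      using A0(2) ideal_on_subset[OF J] unfolding ideal_to_one_def by blast
    then obtain s where "winning_strategy_I J (A \<inter> A0) f s"
      using wins pos[OF finite_inters_Int[OF A A0(1)]] unfolding I_wins_all_games_def by blast
    then obtain M where "meager M" "\<And>r. f -` (\<Union>n. block g n r) \<inter> (A \<inter> A0) \<in> J \<Longrightarrow> r \<in> M"
      using meager_if_I_wins[OF J _ lim] by blast
    then show ?thesis using ideal_on_subset[OF J] by blast
  next
    case False
    have "\<exists>m. N < m \<and> f -` {m} \<inter> A \<notin> J" for N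
    proof -
      \<comment> \<open>Since \<open>{..N}\<close> lies in \<open>I\<close>, some \<open>B\<close>
        makes its preimage small; a fibre that is positive on \<open>A \<inter> B\<close> must then
        lie over a point above \<open>N\<close>.\<close>
      have "\<exists>B\<in>finite_inters \<A>. f -` {..N} \<inter> B \<in> J"
        using small ideal_on_finite[OF I] by blast
      then obtain B where B: "B \<in> finite_inters \<A>" "f -` {..N} \<inter> B \<in> J" by blast
      then obtain m where m: "f -` {m} \<inter> (A \<inter> B) \<notin> J"
        using False finite_inters_Int[OF A] unfolding ideal_to_one_def by blast
      have "\<not> m \<le> N"
      proof
        assume "m \<le> N"
        then have "f -` {m} \<inter> (A \<inter> B) \<subseteq> f -` {..N} \<inter> B" by auto
        then show False using m B(2) ideal_on_subset[OF J] by blast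
      qed
      moreover have "f -` {m} \<inter> A \<notin> J"
        using m ideal_on_subset[OF J] by (metis Int_lower1 Int_assoc)
      ultimately show ?thesis by (intro exI[of _ m]) simp
    qed
    then have inf: "infinite {m. f -` {m} \<inter> A \<notin> J}"
      unfolding infinite_nat_iff_unbounded by blast
    have "\<exists>m. f -` {m} \<inter> A \<notin> J \<and> g m \<le> (1/2) ^ n" for n
    proof -
      have "infinite ({m. f -` {m} \<inter> A \<notin> J} - {m. (1/2) ^ n < g m})"
        using inf lim[of "(1/2) ^ n"] by simp
      then obtain m where "m \<in> {m. f -` {m} \<inter> A \<notin> J} - {m. (1/2) ^ n < g m}"
        using infinite_imp_nonempty by blast
      then show ?thesis by auto
    qed
    then obtain \<phi> where \<phi>: "\<And>n. f -` {\<phi> n} \<inter> A \<notin> J" "\<And>n. g (\<phi> n) \<le> (1/2) ^ n" by metis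
    define M where "M = {r. \<forall>n. block g n r \<noteq> {\<phi> n}}"
    have "nowhere_dense M" unfolding M_def by (rule nowhere_dense_avoid_blocks) (simp_all add: \<phi>)
    then have "meager M" unfolding meager_def by (intro exI[of _ "\<lambda>_. M"]) auto
    moreover have "r \<in> M" if r: "f -` (\<Union>n. block g n r) \<inter> A \<in> J" for r
    proof (rule ccontr)
      assume "r \<notin> M"
      then obtain n where "block g n r = {\<phi> n}" unfolding M_def by blast
      then have "f -` {\<phi> n} \<inter> A \<subseteq> f -` (\<Union>n. block g n r) \<inter> A" by blast
      then show False using \<phi>(1) ideal_on_subset[OF J r] by blast
    qed
    ultimately show ?thesis by blast
  qed
  then obtain M where M: "\<And>A. A \<in> finite_inters \<A> \<Longrightarrow> meager (M A)"
    "\<And>A r. A \<in> finite_inters \<A> \<Longrightarrow> f -` (\<Union>n. block g n r) \<inter> A \<in> J \<Longrightarrow> r \<in> M A"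
    by metis
  define \<C> where "\<C> = M ` finite_inters \<A>"
  have meager: "meager X" if "X \<in> \<C>" for X using that M(1) unfolding \<C>_def by blast
  have "r \<in> \<Union>\<C>" for r
  proof -
    have "(\<Union>n. block g n r) \<in> I"
      using summable_on_blocks[of g, OF g(1)] g(3) unfolding summable_ideal_def by blast
    then show ?thesis using small M(2) unfolding \<C>_def by blast
  qed
  then have cover: "\<Union>\<C> = UNIV" by blast
  \<comment> \<open>A finite family has finitely many intersections, but finitely many meager sets
    do not cover the line.\<close>
  have "infinite \<A>"
  proof
    assume "finite \<A>"
    have "finite_inters \<A> = Inter ` Pow \<A>"
      unfolding finite_inters_def using \<open>finite \<A>\<close> finite_subset by blast
    then have "finite \<C>" unfolding \<C>_def using \<open>finite \<A>\<close> by simp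
    then show False using countable_meager_Union_not_UNIV[of \<C>] meager cover countable_finite by blast
  qed
  have "cov_meager \<le>o |\<C>|" using meager cover by (rule cov_meager_le)
  also have "|\<C>| \<le>o |finite_inters \<A>|" unfolding \<C>_def by (rule card_of_image)
  also have "|finite_inters \<A>| \<le>o |\<A>|" using \<open>infinite \<A>\<close> by (rule card_of_finite_inters)
  finally show ?thesis .
qed

section \<open>Comparison with the default value and conclusion\<close>

lemma cov_meager_le_continuum: "cov_meager \<le>o |UNIV :: nat set set|"
proof -
  have "cov_meager \<le>o |range (\<lambda>x::real. {x})|"
    by (rule cov_meager_le) (auto intro: meager_singleton)
  also have "|range (\<lambda>x::real. {x})| \<le>o |UNIV :: real set|" by (rule card_of_image)
  also have "|UNIV :: real set| \<le>o |UNIV :: nat set set|"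
  proof -
    \<comment> \<open>Dedekind cuts, transferred to sets of naturals by an enumeration of the
      rationals.\<close>
    define h where "h x = {n. real_of_rat (from_nat n) < x}" for x
    have "h x \<noteq> h y" if xy: "x < y" for x y
    proof -
      obtain q where "x < real_of_rat q" "real_of_rat q < y" using of_rat_dense[OF xy] by blast
      then have "to_nat q \<in> h y" "to_nat q \<notin> h x" unfolding h_def by auto
      then show ?thesis by blast
    qed
    then have "inj h" by (metis injI linorder_neqE)
    then show ?thesis unfolding card_of_ordLeq[symmetric] by blast
  qed
  finally show ?thesis .
qed

lemma cov_meager_le_fip:
  assumes "ideal_on UNIV I" "ideal_on UNIV J"
    and S: "is_summable_ideal S" "tall S" "S \<subseteq> I"
    and "I_wins_all_games J"
  shows "cov_meager \<le>o fip I J UNIV"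
proof -
  obtain g where g: "\<And>n. 0 \<le> g n" "S = summable_ideal g"
    using S(1) unfolding is_summable_ideal_def by blast
  have "fip I J UNIV \<in> fip_cards I J UNIV"
    unfolding fip_def by (rule min_card_in[OF fip_cards_nonempty Card_order_fip_cards])
  \<comment> \<open>The minimum is attained: it is either the successor of the continuum or the size
    of a family that some \<open>f\<close> defeats.\<close>
  then consider "fip I J UNIV = cardSuc |UNIV :: nat set set|"
    | \<A> f where "fip I J UNIV =o |\<A>|" "has_FIP J \<A>" "\<And>B. B \<in> I \<Longrightarrow> \<not> has_FIP J (\<A> \<union> {f -` B})"
    unfolding fip_cards_def by blast
  then show ?thesis
  proof cases
    case 1
    have "|UNIV :: nat set set| \<le>o cardSuc |UNIV :: nat set set|"
      by (rule cardSuc_ordLeq[OF card_of_Card_order])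
    then show ?thesis unfolding 1 using cov_meager_le_continuum ordLeq_transitive by blast
  next
    case 2
    have "cov_meager \<le>o |\<A>|"
      by (rule cov_meager_le_witness[OF assms(1,2) g(1) _ _ assms(6) 2(2,3)]) (use S g in auto)
    then show ?thesis using ordLeq_ordIso_trans ordIso_symmetric 2(1) by blast
  qed
qed

theorem theorem5p7:
  fixes I J :: "nat set set"
  assumes "ideal_on UNIV I" and "ideal_on UNIV J"
    and "\<exists>S. is_summable_ideal S \<and> tall S \<and> S \<subseteq> I"
  shows "(I_wins_all_games J \<longrightarrow> cov_meager \<le>o fip I J UNIV) \<and>
         (borel_family J \<and>
          (\<forall>A S. A \<notin> J \<and> is_summable_ideal S \<and> tall S \<longrightarrow>
             \<not> katetov_above A (restrict_ideal J A) S) \<longrightarrow>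
            I_wins_all_games J \<and> cov_meager \<le>o fip I J UNIV)"
proof -
  have le: "cov_meager \<le>o fip I J UNIV" if "I_wins_all_games J"
    using cov_meager_le_fip[OF assms(1,2) _ _ _ that] assms(3) by (elim exE conjE)
  show ?thesis
  proof (intro conjI impI)
    assume "borel_family J \<and> (\<forall>A S. A \<notin> J \<and> is_summable_ideal S \<and> tall S \<longrightarrow>
        \<not> katetov_above A (restrict_ideal J A) S)"
    then show "I_wins_all_games J"
      by (intro Borel_I_wins_all_games[OF assms(2)]) auto
    then show "cov_meager \<le>o fip I J UNIV" by (rule le)
  qed (rule le)
qed

end
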